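(* Let $n\ge2$, let $\varphi:\mathbb{R}^{n-1}\to\mathbb{R}$ be a smooth function, let $\Omega=\{(x',x_n)\in\mathbb{R}^n: x_n>\varphi(x')\}$, and let $W$ be a double well potential satisfying (W1)–(W5) (listed in the context). Let $u$ be a solution of the overdetermined problem $$\Delta u=W'(u),\quad u>0\ \text{ in }\Omega,\qquad u=0\ \text{ on }\partial\Omega,\qquad \frac{\partial u}{\partial\nu}=\text{const. on }\partial\Omega$$ (the constant not being prescribed a priori). Then $|\nabla u|=\sqrt{2W(0)}$ on $\partial\Omega$.
   Context: Here $\nu$ is the outer unit normal to $\partial\Omega$; a solution is a classical one, $u\in C^2(\Omega)\cap C^1(\overline\Omega)$. Assumptions on $W\in C^2([0,+\infty))$: (W1) $W\ge 0$, $W(1)=0$ and $W>0$ in $[0,1)$; (W2) for some $\gamma\in(0,1)$, $W'<0$ on $(\gamma,1)$; (W3) there is a constant $\kappa>0$ with $W''(s)\ge\kappa$ for all $s\ge\gamma$; (W4) there are constants $p>1$ and $c>0$ with $W'(s)\ge c(s-1)^p$ for $s>1$; (W5) $W'<0$ in $(0,1)$, and either $W'(0)\ne0$, or $W'(0)=0$ and $W''(0)\neq0$. *)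

theory Defs
  imports "HOL-Analysis.Analysis"
begin

(* Functions of class C^k on an open set S. In finite dimension, continuity of x |-> D^k f(x)
   is equivalent to continuity of all iterated directional derivatives. *)
fun C_k_on :: "nat \<Rightarrow> 'a::real_normed_vector set \<Rightarrow> ('a \<Rightarrow> 'b::real_normed_vector) \<Rightarrow> bool" where
  "C_k_on 0 S f \<longleftrightarrow> continuous_on S f"
| "C_k_on (Suc k) S f \<longleftrightarrow>
     (\<forall>x\<in>S. f differentiable (at x)) \<and>
     (\<forall>v. C_k_on k S (\<lambda>x. frechet_derivative f (at x) v))"

definition smooth :: "('a::real_normed_vector \<Rightarrow> 'b::real_normed_vector) \<Rightarrow> bool" where
  "smooth f \<longleftrightarrow> (\<forall>k. C_k_on k UNIV f)"

definition laplacian :: "('a::euclidean_space \<Rightarrow> real) \<Rightarrow> 'a \<Rightarrow> real" where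
  "laplacian f x =
     (\<Sum>b\<in>Basis. frechet_derivative (\<lambda>y. frechet_derivative f (at y) b) (at x) b)"

(* The class C^1 up to the boundary of an open set S: f and its gradient on S extend continuously
   to the closure. Df is the extended gradient; it is uniquely determined on closure S, and its
   values on frontier S are what is meant by the gradient of f there. *)
definition C1_closure :: "'a::euclidean_space set \<Rightarrow> ('a \<Rightarrow> real) \<Rightarrow> ('a \<Rightarrow> 'a) \<Rightarrow> bool" where
  "C1_closure S f Df \<longleftrightarrow>
     continuous_on (closure S) f \<and> continuous_on (closure S) Df \<and>
     (\<forall>x\<in>S. GDERIV f x :> Df x)"

(* A unit vector, orthogonal to the boundary at x, with S locally on the side of -\<nu> along the
   normal line. *)
definition outer_unit_normal :: "'a::euclidean_space set \<Rightarrow> 'a \<Rightarrow> 'a \<Rightarrow> bool" where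
  "outer_unit_normal S x \<nu> \<longleftrightarrow>
     x \<in> frontier S \<and> norm \<nu> = 1 \<and>
     ((\<lambda>y. ((y - x) \<bullet> \<nu>) / norm (y - x)) \<longlongrightarrow> 0) (at x within frontier S) \<and>
     (\<forall>\<^sub>F t in at_right 0. x + t *\<^sub>R \<nu> \<notin> S \<and> x - t *\<^sub>R \<nu> \<in> S)"

(* The library's epigraph is the closed one. *)
definition strict_epigraph :: "('a \<Rightarrow> real) \<Rightarrow> ('a \<times> real) set" where
  "strict_epigraph \<phi> = {p. snd p > \<phi> (fst p)}"

lemma frontier_strict_epigraph:
  fixes \<phi> :: "'a::euclidean_space \<Rightarrow> real"
  assumes c: "continuous_on UNIV \<phi>"
  shows "frontier (strict_epigraph \<phi>) = {p. snd p = \<phi> (fst p)}"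
proof -
  have c1: "continuous_on UNIV (\<lambda>p::'a \<times> real. \<phi> (fst p))"
    by (rule continuous_on_compose2[OF c]) (auto intro!: continuous_intros)
  have op: "open (strict_epigraph \<phi>)"
    unfolding strict_epigraph_def
    by (intro open_Collect_less c1 continuous_intros)
  have cl: "closed {p::'a \<times> real. \<phi> (fst p) \<le> snd p}"
    by (intro closed_Collect_le c1 continuous_intros)
  have sub: "closure (strict_epigraph \<phi>) \<subseteq> {p. \<phi> (fst p) \<le> snd p}"
    by (rule closure_minimal[OF _ cl]) (auto simp: strict_epigraph_def)
  have "p \<in> closure (strict_epigraph \<phi>)" if p: "snd p = \<phi> (fst p)" for p
    unfolding closure_approachable
  proof (intro allI impI)
    fix e :: real assume "e > 0"
    then show "\<exists>y\<in>strict_epigraph \<phi>. dist y p < e"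
      by (intro bexI[of _ "(fst p, snd p + e/2)"])
         (auto simp: strict_epigraph_def p dist_prod_def dist_real_def)
  qed
  then show ?thesis
    unfolding frontier_def interior_open[OF op]
    using sub by (force simp: strict_epigraph_def)
qed

lemma outer_unit_normal_strict_epigraph:
  fixes \<phi> :: "'a::euclidean_space \<Rightarrow> real"
  assumes d: "GDERIV \<phi> x :> g" and c: "continuous_on UNIV \<phi>"
  shows "outer_unit_normal (strict_epigraph \<phi>) (x, \<phi> x) \<nu> \<longleftrightarrow>
         \<nu> = (g, -1) /\<^sub>R sqrt (1 + (norm g)\<^sup>2)"
proof -
  define r where "r = sqrt (1 + (norm g)\<^sup>2)"
  have r: "r > 0" "r * r = 1 + g \<bullet> g"
    by (auto simp: r_def dot_square_norm add_pos_nonneg)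
  let ?S = "strict_epigraph \<phi>" and ?p = "(x, \<phi> x)" and ?N = "(g, -1::real) /\<^sub>R r"
  have d': "(\<phi> has_derivative (\<lambda>h. h \<bullet> g)) (at x)"
    using d by (simp add: gderiv_def)
  have line: "((\<lambda>t. \<phi> (x + t *\<^sub>R h)) has_real_derivative (h \<bullet> g)) (at 0)" for h
  proof -
    have "((\<lambda>t. x + t *\<^sub>R h) has_derivative (\<lambda>t. t *\<^sub>R h)) (at 0)"
      by (auto intro!: derivative_eq_intros)
    then have "((\<lambda>t. \<phi> (x + t *\<^sub>R h)) has_derivative (\<lambda>t. (t *\<^sub>R h) \<bullet> g)) (at 0)"
      by (rule has_derivative_compose) (use d' in simp)
    then show ?thesis
      by (simp add: has_field_derivative_def mult.commute[of _ "h \<bullet> g"])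
  qed
  have side: "\<forall>\<^sub>F t in at_right 0. ?p + t *\<^sub>R ?N \<notin> ?S \<and> ?p - t *\<^sub>R ?N \<in> ?S"
  proof -
    let ?f = "\<lambda>t. \<phi> (x + t *\<^sub>R (g /\<^sub>R r)) - (\<phi> x - t / r)"
    have D: "(?f has_real_derivative ((g /\<^sub>R r) \<bullet> g - (0 - 1 / r))) (at 0)"
      by (intro derivative_intros line DERIV_cdivide)
    have pos: "(g /\<^sub>R r) \<bullet> g - (0 - 1 / r) > 0"
      using r by (auto intro!: add_nonneg_pos)
    obtain d1 where d1: "d1 > 0" "\<And>h. 0 < h \<Longrightarrow> h < d1 \<Longrightarrow> ?f 0 < ?f (0 + h)"
      using DERIV_pos_inc_right[OF D pos] by auto
    obtain d2 where d2: "d2 > 0" "\<And>h. 0 < h \<Longrightarrow> h < d2 \<Longrightarrow> ?f (0 - h) < ?f 0"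
      using DERIV_pos_inc_left[OF D pos] by auto
    show ?thesis
      unfolding eventually_at_right_field
    proof (intro exI[of _ "min d1 d2"] conjI allI impI)
      show "0 < min d1 d2" using d1 d2 by simp
      fix t :: real assume t: "0 < t" "t < min d1 d2"
      show "?p + t *\<^sub>R ?N \<notin> ?S"
        using d1(2)[of t] t by (auto simp: strict_epigraph_def divide_inverse)
      show "?p - t *\<^sub>R ?N \<in> ?S"
        using d2(2)[of t] t by (auto simp: strict_epigraph_def divide_inverse)
    qed
  qed
  have nN: "norm ?N = 1"
  proof -
    have "norm (g, -1::real) = r" by (simp add: norm_Pair r_def add.commute)
    then show ?thesis unfolding norm_scaleR using r by simp
  qed
  have tang: "((\<lambda>y. ((y - ?p) \<bullet> ?N) / norm (y - ?p)) \<longlongrightarrow> 0) (at ?p within frontier ?S)"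
    unfolding Lim_within
  proof (intro allI impI)
    fix e :: real assume e: "e > 0"
    then have "e * r / 2 > 0" using r by simp
    then obtain \<delta> where \<delta>: "\<delta> > 0" 
      "\<And>y. norm (y - x) < \<delta> \<Longrightarrow> norm (\<phi> y - \<phi> x - (y - x) \<bullet> g) \<le> e * r / 2 * norm (y - x)"
      using d' unfolding has_derivative_at_alt by metis
    show "\<exists>\<delta>>0. \<forall>y\<in>frontier ?S. 0 < dist y ?p \<and> dist y ?p < \<delta> \<longrightarrow>
            dist (((y - ?p) \<bullet> ?N) / norm (y - ?p)) 0 < e"
    proof (intro exI[of _ \<delta>] conjI ballI impI)
      show "\<delta> > 0" by fact
      fix q assume "q \<in> frontier ?S" and q: "0 < dist q ?p \<and> dist q ?p < \<delta>"
      then obtain y where y: "q = (y, \<phi> y)"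
        by (cases q) (auto simp: frontier_strict_epigraph[OF c])
      have le: "norm (y - x) \<le> norm (q - ?p)"
        using norm_fst_le[of "y - x" "\<phi> y - \<phi> x"] by (simp add: y)
      have pos: "norm (q - ?p) > 0" using q by (simp add: dist_norm)
      have "(q - ?p) \<bullet> ?N = - (\<phi> y - \<phi> x - (y - x) \<bullet> g) / r"
        by (simp add: y inner_diff_left divide_simps algebra_simps)
      then have "\<bar>(q - ?p) \<bullet> ?N\<bar> = \<bar>\<phi> y - \<phi> x - (y - x) \<bullet> g\<bar> / r"
        using r by (simp add: abs_divide)
      also have "\<dots> \<le> (e * r / 2 * norm (y - x)) / r"
        using \<delta>(2)[of y] le q r by (intro divide_right_mono) (auto simp: dist_norm)
      also have "\<dots> = e / 2 * norm (y - x)" using r by simp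
      also have "\<dots> \<le> e / 2 * norm (q - ?p)" using le e by (intro mult_left_mono) auto
      also have "\<dots> < e * norm (q - ?p)" using e pos by simp
      finally show "dist (((q - ?p) \<bullet> ?N) / norm (q - ?p)) 0 < e"
        using pos by (simp add: abs_divide pos_divide_less_eq)
    qed
  qed
  have "\<nu> = ?N" if n: "outer_unit_normal ?S ?p \<nu>"
  proof -
    obtain v s where \<nu>: "\<nu> = (v, s)" by (cases \<nu>)
    have ort: "h \<bullet> v + (h \<bullet> g) * s = 0" for h
    proof (cases "h = 0")
      case False
      let ?q = "\<lambda>t. (x + t *\<^sub>R h, \<phi> (x + t *\<^sub>R h))"
      have l1: "((\<lambda>t. (\<phi> (x + t *\<^sub>R h) - \<phi> x) / t) \<longlongrightarrow> h \<bullet> g) (at_right 0)"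
        using line[of h] unfolding has_field_derivative_iff
        by (auto intro: filterlim_mono[OF _ order_refl] simp: at_le)
      have l2: "((\<lambda>t. (?q t - ?p) /\<^sub>R t) \<longlongrightarrow> (h, h \<bullet> g)) (at_right 0)"
      proof (rule Lim_transform_eventually)
        show "((\<lambda>t. (h, (\<phi> (x + t *\<^sub>R h) - \<phi> x) / t)) \<longlongrightarrow> (h, h \<bullet> g)) (at_right 0)"
          by (intro tendsto_intros l1)
        show "\<forall>\<^sub>F t in at_right 0. (h, (\<phi> (x + t *\<^sub>R h) - \<phi> x) / t) = (?q t - ?p) /\<^sub>R t"
          by (auto simp: eventually_at_right_field divide_inverse mult.commute intro!: exI[of _ 1])
      qed
      have "filterlim ?q (at ?p within frontier ?S) (at_right 0)"
        unfolding filterlim_at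
      proof
        show "\<forall>\<^sub>F t in at_right 0. ?q t \<in> frontier ?S \<and> ?q t \<noteq> ?p"
          using False
          by (auto simp: eventually_at_right_field frontier_strict_epigraph[OF c] intro!: exI[of _ 1])
        have "isCont (\<lambda>t. \<phi> (x + t *\<^sub>R h)) 0"
          using line[of h] by (rule DERIV_isCont)
        then have "((\<lambda>t. \<phi> (x + t *\<^sub>R h)) \<longlongrightarrow> \<phi> x) (at_right 0)"
          by (auto simp: isCont_def intro: filterlim_mono[OF _ order_refl] at_le)
        moreover have "((\<lambda>t. x + t *\<^sub>R h) \<longlongrightarrow> x + 0 *\<^sub>R h) (at_right 0)"
          by (intro tendsto_intros)
        ultimately show "(?q \<longlongrightarrow> ?p) (at_right 0)"
          by (intro tendsto_Pair) auto
      qed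
      then have "((\<lambda>t. ((?q t - ?p) \<bullet> \<nu>) / norm (?q t - ?p)) \<longlongrightarrow> 0) (at_right 0)"
        using n filterlim_compose unfolding outer_unit_normal_def by blast
      then have "((\<lambda>t. ((?q t - ?p) \<bullet> \<nu>) / norm (?q t - ?p) * norm ((?q t - ?p) /\<^sub>R t))
          \<longlongrightarrow> 0 * norm (h, h \<bullet> g)) (at_right 0)"
        by (intro tendsto_mult tendsto_norm l2)
      then have "((\<lambda>t. ((?q t - ?p) /\<^sub>R t) \<bullet> \<nu>) \<longlongrightarrow> 0 * norm (h, h \<bullet> g)) (at_right 0)"
      proof (rule Lim_transform_eventually)
        show "\<forall>\<^sub>F t in at_right 0. ((?q t - ?p) \<bullet> \<nu>) / norm (?q t - ?p) * norm ((?q t - ?p) /\<^sub>R t)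
             = ((?q t - ?p) /\<^sub>R t) \<bullet> \<nu>"
        proof -
          have "((?q t - ?p) \<bullet> \<nu>) / norm (?q t - ?p) * norm ((?q t - ?p) /\<^sub>R t)
             = ((?q t - ?p) /\<^sub>R t) \<bullet> \<nu>" if "t > 0" for t
            unfolding norm_scaleR inner_scaleR_left using that False
            by (simp add: zero_prod_def)
          then show ?thesis by (auto simp: eventually_at_right_field intro!: exI[of _ 1])
        qed
      qed
      moreover have "((\<lambda>t. ((?q t - ?p) /\<^sub>R t) \<bullet> \<nu>) \<longlongrightarrow> (h, h \<bullet> g) \<bullet> \<nu>) (at_right 0)"
        by (intro tendsto_inner l2 tendsto_const)
      ultimately have "(h, h \<bullet> g) \<bullet> \<nu> = 0"
        using tendsto_unique[OF trivial_limit_at_right_real] by fastforce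
      then show ?thesis by (simp add: \<nu>)
    qed simp
    have "v + s *\<^sub>R g = 0"
    proof -
      have "h \<bullet> (v + s *\<^sub>R g) = 0" for h
        using ort[of h] by (simp add: inner_add_right mult.commute)
      then show ?thesis using inner_eq_zero_iff by blast
    qed
    then have v: "v = - (s *\<^sub>R g)" by (simp add: eq_neg_iff_add_eq_0)
    have "norm \<nu> = 1" using n by (simp add: outer_unit_normal_def)
    then have "\<nu> \<bullet> \<nu> = 1" by (simp add: dot_square_norm)
    then have "s * s * (r * r) = 1" unfolding r(2) by (simp add: \<nu> v algebra_simps)
    then have "(s * r)\<^sup>2 = 1" by (simp add: power2_eq_square mult_ac)
    then have "s * r = 1 \<or> s * r = -1" by (simp add: power2_eq_1_iff)
    moreover have "s * r \<noteq> 1"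
    proof
      assume "s * r = 1"
      then have "s = inverse r" using r by (simp add: field_simps)
      then have "\<nu> = - ?N" by (simp add: \<nu> v)
      then have "\<forall>\<^sub>F t in at_right 0. ?p + t *\<^sub>R ?N \<in> ?S"
        using n by (auto simp: outer_unit_normal_def elim!: eventually_mono)
      with side have "\<forall>\<^sub>F t in at_right (0::real). False"
        by eventually_elim auto
      then show False by simp
    qed
    ultimately have "s = - inverse r" using r by (simp add: field_simps)
    then show ?thesis by (simp add: \<nu> v)
  qed
  moreover have "outer_unit_normal ?S ?p ?N"
    unfolding outer_unit_normal_def
    using nN tang side by (auto simp: frontier_strict_epigraph[OF c])
  ultimately show ?thesis unfolding r_def by blast
qed

end

theory Submission
  imports Defs
begin

text \<open>
  An epigraph contains balls of every radius touching its boundary from inside, and so does its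
  complement. Let \<open>G\<close> be a perturbation of \<open>W\<close>, and let \<open>T\<close> be the inverse of the one-dimensional
  profile \<open>h' = sqrt (2 G h)\<close>, \<open>h 0 = 0\<close>. At an interior extremum of \<open>T u - |x - c|\<close> (exterior ball)
  or \<open>T u + |x - c|\<close> (interior ball) the first-order condition gives \<open>|\<nabla>u|\<^sup>2 = 2 G u\<close>, and the
  second-order condition then compares \<open>G' - W'\<close> with a curvature term of order one over the radius,
  which is impossible for large radius. So \<open>u\<close> is compared with \<open>h\<close> of the distance to the ball, and
  at the touching point the normal derivative is compared with \<open>sqrt (2 G 0)\<close>, which is close to
  \<open>sqrt (2 W 0)\<close>. As \<open>|\<nabla>u|\<close> is constant on the boundary, the two touching points suffice.

  The exterior comparison needs \<open>u \<le> 1\<close> (Keller--Osserman), the interior one needs \<open>u\<close> close to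
  \<open>1\<close> at a fixed distance from the boundary, which follows from (W5).
\<close>

subsection \<open>Second-order conditions at a touching point\<close>

text \<open>If \<open>D > 0\<close>, then \<open>f'\<close>, which vanishes at \<open>x\<close>, is
  positive just to the right of \<open>x\<close>, and the mean value theorem lifts \<open>f\<close>
  above its maximum there.\<close>

lemma local_max_second_derivative:
  fixes f f' :: "real \<Rightarrow> real"
  assumes d: "\<forall>\<^sub>F t in nhds x. (f has_real_derivative f' t) (at t)"
    and d2: "(f' has_real_derivative D) (at x)"
    and mx: "\<forall>\<^sub>F t in nhds x. f t \<le> f x"
  shows "f' x = 0" "D \<le> 0"
proof -
  obtain e where e: "e > 0" "\<And>t. dist t x < e \<Longrightarrow> (f has_real_derivative f' t) (at t)"
      "\<And>t. dist t x < e \<Longrightarrow> f t \<le> f x"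
    using eventually_conj[OF d mx] unfolding eventually_nhds_metric by blast
  show z: "f' x = 0"
    using DERIV_local_max[OF e(2)[of x] e(1)] e by (auto simp: dist_real_def abs_minus_commute)
  show "D \<le> 0"
  proof (rule ccontr)
    assume "\<not> D \<le> 0"
    then obtain a where a: "a > 0" "\<And>h. 0 < h \<Longrightarrow> h < a \<Longrightarrow> f' x < f' (x + h)"
      using DERIV_pos_inc_right[OF d2] by force
    define h where "h = min a e / 2"
    have h: "0 < h" "h < a" "h < e" using a(1) e(1) by (auto simp: h_def)
    have "\<exists>\<xi>. x < \<xi> \<and> \<xi> < x + h \<and> f (x + h) - f x = (x + h - x) * f' \<xi>"
      by (rule MVT2) (use h e(2) in \<open>auto simp: dist_real_def\<close>)
    then obtain \<xi> where \<xi>: "x < \<xi>" "\<xi> < x + h" "f (x + h) - f x = h * f' \<xi>" by auto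
    have "f' \<xi> > 0" using a(2)[of "\<xi> - x"] \<xi> h z by auto
    then have "h * f' \<xi> > 0" using h by simp
    moreover have "f (x + h) \<le> f x" using e(3)[of "x + h"] h by (simp add: dist_real_def)
    ultimately show False using \<xi>(3) by simp
  qed
qed

text \<open>Restricts \<open>u\<close> to a line so that the one-variable test applies; for
  \<open>b\<close> in the basis the second derivative is the diagonal Hessian entry summed in
  \<open>laplacian\<close>.\<close>

lemma C2_directional_derivatives:
  fixes u :: "'a::euclidean_space \<Rightarrow> real"
  assumes u: "C_k_on 2 S u" and y: "y + t *\<^sub>R b \<in> S"
  shows "((\<lambda>t. u (y + t *\<^sub>R b)) has_real_derivative
            frechet_derivative u (at (y + t *\<^sub>R b)) b) (at t)"
    and "((\<lambda>t. frechet_derivative u (at (y + t *\<^sub>R b)) b) has_real_derivative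
            frechet_derivative (\<lambda>x. frechet_derivative u (at x) b) (at (y + t *\<^sub>R b)) b) (at t)"
proof -
  have line: "((\<lambda>t. y + t *\<^sub>R b) has_derivative (\<lambda>h. h *\<^sub>R b)) (at t)"
    by (auto intro!: derivative_eq_intros)
  have *: "((\<lambda>t. g (y + t *\<^sub>R b)) has_real_derivative frechet_derivative g (at (y + t *\<^sub>R b)) b) (at t)"
    if g: "g differentiable (at (y + t *\<^sub>R b))" for g :: "'a \<Rightarrow> real"
  proof -
    have D: "(g has_derivative frechet_derivative g (at (y + t *\<^sub>R b))) (at (y + t *\<^sub>R b))"
      using g frechet_derivative_works by blast
    have "((\<lambda>t. g (y + t *\<^sub>R b)) has_derivative
        (\<lambda>h. frechet_derivative g (at (y + t *\<^sub>R b)) (h *\<^sub>R b))) (at t)"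
      using has_derivative_compose[OF line D] by simp
    moreover have "frechet_derivative g (at (y + t *\<^sub>R b)) (h *\<^sub>R b)
        = frechet_derivative g (at (y + t *\<^sub>R b)) b * h" for h
      using linear_scale[OF has_derivative_linear[OF D], of h b] by simp
    ultimately show ?thesis by (simp add: has_field_derivative_def)
  qed
  show "((\<lambda>t. u (y + t *\<^sub>R b)) has_real_derivative
            frechet_derivative u (at (y + t *\<^sub>R b)) b) (at t)"
    using u y by (intro *) (auto simp: numeral_2_eq_2)
  show "((\<lambda>t. frechet_derivative u (at (y + t *\<^sub>R b)) b) has_real_derivative
            frechet_derivative (\<lambda>x. frechet_derivative u (at x) b) (at (y + t *\<^sub>R b)) b) (at t)"
    using u y by (intro *) (auto simp: numeral_2_eq_2)
qed

text \<open>The one-variable test is applied in each coordinate direction. Summing the second-order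
  conditions compares the Laplacians of \<open>T (u y)\<close> and of the barrier; summing the
  squared first-order conditions compares their gradients. The barrier is a function of the squared
  distance because that is a quadratic polynomial on every line.\<close>

lemma touching:
  fixes u :: "'a::euclidean_space \<Rightarrow> real"
  assumes S: "open S" "x \<in> S" and u: "C_k_on 2 S u"
    and T: "\<forall>\<^sub>F s in nhds (u x). (T has_real_derivative T' s) (at s)"
      "(T' has_real_derivative T'') (at (u x))"
    and F: "\<forall>\<^sub>F s in nhds ((norm (x - c))\<^sup>2). (F has_real_derivative F' s) (at s)"
      "(F' has_real_derivative F'') (at ((norm (x - c))\<^sup>2))"
    and mx: "\<forall>\<^sub>F y in nhds x. T (u y) - F ((norm (y - c))\<^sup>2) \<le> T (u x) - F ((norm (x - c))\<^sup>2)"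
  shows "T'' * (\<Sum>b\<in>Basis. (frechet_derivative u (at x) b)\<^sup>2) + T' (u x) * laplacian u x
       \<le> 4 * (norm (x - c))\<^sup>2 * F'' + 2 * real DIM('a) * F' ((norm (x - c))\<^sup>2)"
    and "(T' (u x))\<^sup>2 * (\<Sum>b\<in>Basis. (frechet_derivative u (at x) b)\<^sup>2)
       = 4 * (F' ((norm (x - c))\<^sup>2))\<^sup>2 * (norm (x - c))\<^sup>2"
proof -
  define D where "D b = (\<lambda>y. frechet_derivative u (at y) b)" for b
  define H where "H b = frechet_derivative (D b) (at x) b" for b
  define Q where "Q = (norm (x - c))\<^sup>2"
  define q where "q b t = (norm (x + t *\<^sub>R b - c))\<^sup>2" for b t
  have key: "T' (u x) * D b x = F' Q * (2 * ((x - c) \<bullet> b)) \<and>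
        T'' * (D b x)\<^sup>2 + T' (u x) * H b - (F'' * (2 * ((x - c) \<bullet> b))\<^sup>2 + 2 * F' Q) \<le> 0"
    if b: "b \<in> Basis" for b
  proof -
    have qe: "q b = (\<lambda>t. Q + 2 * t * ((x - c) \<bullet> b) + t * t)"
    proof
      fix t
      have "q b t = ((x - c) + t *\<^sub>R b) \<bullet> ((x - c) + t *\<^sub>R b)"
        by (simp add: q_def dot_square_norm algebra_simps)
      also have "\<dots> = Q + 2 * t * ((x - c) \<bullet> b) + t * t"
        using b by (simp add: inner_left_distrib inner_right_distrib Q_def power2_norm_eq_inner inner_commute)
      finally show "q b t = Q + 2 * t * ((x - c) \<bullet> b) + t * t" .
    qed
    have q': "(q b has_real_derivative 2 * ((x - c) \<bullet> b) + 2 * t) (at t)" for t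
      unfolding qe by (auto intro!: derivative_eq_intros)
    have q0: "q b 0 = Q" by (simp add: qe)
    let ?l = "\<lambda>t. x + t *\<^sub>R b"
    have lt: "(?l \<longlongrightarrow> x) (nhds 0)"
      by (auto intro!: tendsto_eq_intros filterlim_ident)
    have ut: "((\<lambda>t. u (?l t)) \<longlongrightarrow> u x) (nhds 0)"
    proof -
      have "isCont u x" using u S(2)
        by (auto simp: numeral_2_eq_2 intro: differentiable_imp_continuous_within)
      then have "filterlim u (nhds (u x)) (nhds x)" by (simp add: tendsto_at_iff_tendsto_nhds isCont_def)
      then show ?thesis using lt by (rule filterlim_compose)
    qed
    have qt: "(q b \<longlongrightarrow> Q) (nhds 0)"
      unfolding qe by (auto intro!: tendsto_eq_intros filterlim_ident)
    have eS: "\<forall>\<^sub>F t in nhds 0. ?l t \<in> S"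
      using lt S by (rule topological_tendstoD)
    define f where "f = (\<lambda>t. T (u (?l t)) - F (q b t))"
    define f' where "f' = (\<lambda>t. T' (u (?l t)) * D b (?l t) - F' (q b t) * (2 * ((x - c) \<bullet> b) + 2 * t))"
    have du: "((\<lambda>t. u (?l t)) has_real_derivative D b (?l t)) (at t)"
      and dD: "((\<lambda>t. D b (?l t)) has_real_derivative frechet_derivative (D b) (at (?l t)) b) (at t)"
      if "?l t \<in> S" for t
      using C2_directional_derivatives[OF u that] unfolding D_def by blast+
    \<comment> \<open>\<open>T\<close> and \<open>F\<close> are differentiable only near the contact
      values; continuity of \<open>u\<close> and \<open>q b\<close> brings this back to small
      \<open>t\<close>.\<close>
    have e1: "\<forall>\<^sub>F t in nhds 0. (f has_real_derivative f' t) (at t)"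
      using eS eventually_compose_filterlim[OF T(1) ut]
        eventually_compose_filterlim[OF F(1) qt[unfolded Q_def]]
    proof eventually_elim
      case (elim t)
      show ?case unfolding f_def f'_def
        by (intro DERIV_diff DERIV_chain2[where g = "\<lambda>t. u (?l t)", OF elim(2)]
              DERIV_chain2[where g = "q b", OF elim(3)] du[OF elim(1)] q')
    qed
    have x0: "?l 0 \<in> S" "?l 0 = x" using S by auto
    have T'': "(T' has_real_derivative T'') (at (u (?l 0)))" using T(2) by simp
    have F'': "(F' has_real_derivative F'') (at (q b 0))" using F(2) by (simp add: q0 Q_def)
    have lin: "((\<lambda>t. 2 * ((x - c) \<bullet> b) + 2 * t) has_real_derivative 2) (at 0)"
      by (auto intro!: derivative_eq_intros)
    have e2: "(f' has_real_derivative ((T'' * D b x) * D b x + H b * T' (u x)) -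
         ((F'' * (2 * ((x - c) \<bullet> b))) * (2 * ((x - c) \<bullet> b)) + 2 * F' Q)) (at 0)"
      unfolding f'_def
      using DERIV_diff[OF
          DERIV_mult[OF DERIV_chain2[where g = "\<lambda>t. u (?l t)", OF T'' du[OF x0(1)]] dD[OF x0(1)]]
          DERIV_mult[OF DERIV_chain2[where g = "q b", OF F'' q'] lin]]
      by (simp add: q0 H_def algebra_simps)
    have e3: "\<forall>\<^sub>F t in nhds 0. f t \<le> f 0"
      using eventually_compose_filterlim[OF mx lt]
      by (auto simp: f_def q_def elim: eventually_mono)
    show ?thesis
      using local_max_second_derivative[OF e1 e2 e3]
      by (simp add: f'_def q0 power2_eq_square algebra_simps)
  qed
  have pars: "(\<Sum>b\<in>Basis. ((x - c) \<bullet> b)\<^sup>2) = Q"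
    by (simp add: Q_def norm_eq_sqrt_inner[of "x-c"] euclidean_inner[of "x-c" "x-c"] power2_eq_square sum_nonneg)
  have lap: "laplacian u x = (\<Sum>b\<in>Basis. H b)"
    by (simp add: laplacian_def H_def D_def)
  have "(\<Sum>b\<in>Basis. T'' * (D b x)\<^sup>2 + T' (u x) * H b - (F'' * (2 * ((x - c) \<bullet> b))\<^sup>2 + 2 * F' Q)) \<le> 0"
    using key by (intro sum_nonpos) blast
  also have "(\<Sum>b\<in>Basis. T'' * (D b x)\<^sup>2 + T' (u x) * H b - (F'' * (2 * ((x - c) \<bullet> b))\<^sup>2 + 2 * F' Q))
      = T'' * (\<Sum>b\<in>Basis. (D b x)\<^sup>2) + T' (u x) * laplacian u x
        - (4 * F'' * (\<Sum>b\<in>Basis. ((x - c) \<bullet> b)\<^sup>2) + 2 * real DIM('a) * F' Q)"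
    by (simp add: sum.distrib sum_subtractf sum_distrib_left sum_distrib_right lap power_mult_distrib mult_ac)
  finally show "T'' * (\<Sum>b\<in>Basis. (frechet_derivative u (at x) b)\<^sup>2) + T' (u x) * laplacian u x
       \<le> 4 * (norm (x - c))\<^sup>2 * F'' + 2 * real DIM('a) * F' ((norm (x - c))\<^sup>2)"
    unfolding pars by (simp add: D_def Q_def mult_ac)
  have "(T' (u x))\<^sup>2 * (\<Sum>b\<in>Basis. (D b x)\<^sup>2) = (\<Sum>b\<in>Basis. (T' (u x) * D b x)\<^sup>2)"
    by (simp add: sum_distrib_left power_mult_distrib)
  also have "\<dots> = (\<Sum>b\<in>Basis. (F' Q * (2 * ((x - c) \<bullet> b)))\<^sup>2)"
    using key by (intro sum.cong) auto
  also have "\<dots> = 4 * (F' Q)\<^sup>2 * (\<Sum>b\<in>Basis. ((x - c) \<bullet> b)\<^sup>2)"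
    by (simp add: sum_distrib_left power_mult_distrib mult_ac)
  finally show "(T' (u x))\<^sup>2 * (\<Sum>b\<in>Basis. (frechet_derivative u (at x) b)\<^sup>2)
       = 4 * (F' ((norm (x - c))\<^sup>2))\<^sup>2 * (norm (x - c))\<^sup>2"
    unfolding pars by (simp add: D_def Q_def)
qed

text \<open>The barrier is the distance to \<open>c\<close>; \<open>T\<close> straightens the one-dimensional profile
  \<open>h' = sqrt (2 G h)\<close>, being its inverse function.\<close>
lemma touching_profile:
  fixes u :: "'a::euclidean_space \<Rightarrow> real"
  assumes S: "open S" "x \<in> S" and u: "C_k_on 2 S u" and xc: "x \<noteq> c"
    and \<sigma>: "\<sigma> = 1 \<or> \<sigma> = - 1"
    and T: "\<forall>\<^sub>F s in nhds (u x). (T has_real_derivative 1 / sqrt (2 * G s)) (at s)"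
    and G: "(G has_real_derivative G') (at (u x))" "G (u x) > 0"
    and mx: "\<forall>\<^sub>F y in nhds x. \<sigma> * T (u y) - norm (y - c) \<le> \<sigma> * T (u x) - norm (x - c)"
  shows "\<sigma> * (laplacian u x - G') \<le> (real DIM('a) - 1) * sqrt (2 * G (u x)) / norm (x - c)"
proof -
  define g where "g = sqrt (2 * G (u x))"
  define r where "r = norm (x - c)"
  have g: "g > 0" "g * g = 2 * G (u x)" and r: "r > 0" using G(2) xc by (auto simp: g_def r_def)
  have sr: "sqrt (r\<^sup>2) = r" using r by simp
  have T1: "\<forall>\<^sub>F s in nhds (u x). ((\<lambda>s. \<sigma> * T s) has_real_derivative \<sigma> * (1 / sqrt (2 * G s))) (at s)"
    using T by eventually_elim (rule DERIV_cmult)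
  have T2: "((\<lambda>s. \<sigma> * (1 / sqrt (2 * G s))) has_real_derivative \<sigma> * (- G' / (g * g * g))) (at (u x))"
  proof -
    have "((\<lambda>s. sqrt (2 * G s)) has_real_derivative inverse (sqrt (2 * G (u x))) / 2 * (2 * G')) (at (u x))"
      by (rule DERIV_chain2[OF DERIV_real_sqrt DERIV_cmult[OF G(1)]]) (use G(2) in simp)
    also have "inverse (sqrt (2 * G (u x))) / 2 * (2 * G') = G' / g"
      unfolding g_def[symmetric] by (simp add: field_simps)
    finally have k: "((\<lambda>s. sqrt (2 * G s)) has_real_derivative G' / g) (at (u x))" .
    have "((\<lambda>s. \<sigma> * (1 / sqrt (2 * G s))) has_real_derivative
        \<sigma> * ((0 * g - 1 * (G' / g)) / (g * g))) (at (u x))"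
      by (rule DERIV_cmult[OF DERIV_divide[OF DERIV_const k, folded g_def]]) (use g(1) in simp)
    also have "\<sigma> * ((0 * g - 1 * (G' / g)) / (g * g)) = \<sigma> * (- G' / (g * g * g))"
      using g(1) by simp
    finally show ?thesis .
  qed
  have F1: "\<forall>\<^sub>F s in nhds ((norm (x - c))\<^sup>2). (sqrt has_real_derivative 1 / (2 * sqrt s)) (at s)"
  proof -
    have "\<forall>\<^sub>F s in nhds (r\<^sup>2). s \<in> {0<..}"
      using r by (intro eventually_nhds_in_open) auto
    then show ?thesis unfolding r_def
      by eventually_elim (auto intro!: derivative_eq_intros simp: divide_simps)
  qed
  have F2: "((\<lambda>s. 1 / (2 * sqrt s)) has_real_derivative - 1 / (4 * r * r * r)) (at ((norm (x - c))\<^sup>2))"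
    unfolding r_def[symmetric] using r sr
    by (auto intro!: derivative_eq_intros simp: divide_simps power2_eq_square)
  have mx': "\<forall>\<^sub>F y in nhds x. \<sigma> * T (u y) - sqrt ((norm (y - c))\<^sup>2) \<le> \<sigma> * T (u x) - sqrt ((norm (x - c))\<^sup>2)"
    using mx by simp
  note t = touching[OF S u T1 T2 F1 F2 mx', folded r_def, unfolded sr]
  let ?N = "\<Sum>b\<in>Basis. (frechet_derivative u (at x) b)\<^sup>2"
  \<comment> \<open>The distance to \<open>c\<close> has gradient of norm one, so equality of the
    gradients says that the gradient of \<open>u\<close> has norm \<open>g\<close>.\<close>
  have "(1 / g)\<^sup>2 * ?N = 1"
    using t(2) r \<sigma> by (auto simp: g_def[symmetric] divide_simps power2_eq_square)
  then have N: "?N = g * g" using g by (simp add: power2_eq_square field_simps)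
  \<comment> \<open>The term with the second derivative of \<open>T\<close> collapses to
    \<open>- \<sigma> * G' / g\<close>; the right-hand side is the Laplacian of the distance,
    dimension minus one over \<open>r\<close>.\<close>
  have "\<sigma> * (- G' / (g * g * g)) * (g * g) + \<sigma> * (1 / g) * laplacian u x
      \<le> 4 * r\<^sup>2 * (- 1 / (4 * r * r * r)) + 2 * real DIM('a) * (1 / (2 * r))"
    using t(1) unfolding N g_def[symmetric] .
  also have "4 * r\<^sup>2 * (- 1 / (4 * r * r * r)) + 2 * real DIM('a) * (1 / (2 * r)) = (real DIM('a) - 1) / r"
    using r by (simp add: power2_eq_square field_simps)
  also have "\<sigma> * (- G' / (g * g * g)) * (g * g) + \<sigma> * (1 / g) * laplacian u x
      = \<sigma> * (laplacian u x - G') / g"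
    using g(1) by (simp add: field_simps)
  finally have "\<sigma> * (laplacian u x - G') \<le> (real DIM('a) - 1) / r * g"
    using g(1) by (simp add: pos_divide_le_eq)
  then show ?thesis by (simp add: g_def r_def)
qed

subsection \<open>A priori bounds\<close>

text \<open>On a ball of radius \<open>R\<close> about \<open>x\<close>, the weighted excess
  \<open>(u - 1) * d powr \<alpha>\<close> vanishes on the sphere and is nonpositive on the frontier
  of \<open>S\<close>, so a positive maximum is attained inside. There \<open>u - 1\<close> is
  touched from above by a barrier that blows up on the sphere, and the superlinear growth bounds the
  excess at \<open>x\<close> by a power of \<open>1 / R\<close>. Since \<open>S\<close> meets every
  such ball in a bounded set, \<open>R\<close> may tend to infinity.\<close>

lemma Keller_Osserman_le_1:
  fixes u :: "'a::euclidean_space \<Rightarrow> real"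
  assumes S: "open S" and u: "C_k_on 2 S u" and cont: "continuous_on (closure S) u"
    and bdry: "\<forall>x\<in>frontier S. u x \<le> 1"
    and pc: "p > 1" "c > 0"
    and lap: "\<forall>x\<in>S. u x > 1 \<longrightarrow> laplacian u x \<ge> c * (u x - 1) powr p"
    and x: "x \<in> S"
  shows "u x \<le> 1"
proof (rule ccontr)
  assume "\<not> u x \<le> 1"
  then have ux: "u x > 1" by simp
  \<comment> \<open>With this exponent the Laplacian of \<open>d powr (- \<alpha>)\<close> and its
    \<open>p\<close>-th power blow up at the same rate, like
    \<open>d powr (- \<alpha> - 2)\<close>.\<close>
  define \<alpha> where "\<alpha> = 2 / (p - 1)"
  have \<alpha>: "\<alpha> > 0" "\<alpha> * p = \<alpha> + 2" using pc by (auto simp: \<alpha>_def field_simps)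
  define C where "C = 4 * \<alpha> * (\<alpha> + 1) + 2 * real DIM('a) * \<alpha>"
  have C: "C > 0" using \<alpha> by (auto simp: C_def intro!: add_pos_pos mult_pos_pos)
  have bound: "(u x - 1) powr (p - 1) * c \<le> C / R\<^sup>2" if R: "R > 0" for R
  proof -
    define d where "d = (\<lambda>y. R\<^sup>2 - (norm (y - x))\<^sup>2)"
    define K where "K = closure S \<inter> cball x R"
    have K: "compact K" "K \<noteq> {}" using x R closure_subset[of S]
      by (auto simp: K_def closed_Int_compact)
    have dK: "d y \<ge> 0" if "y \<in> K" for y
      using that R by (auto simp: K_def d_def dist_norm norm_minus_commute intro: power_mono)
    have "continuous_on K (\<lambda>y. (u y - 1) * d y powr \<alpha>)"
      using \<alpha> dK unfolding d_def
      by (intro continuous_intros continuous_on_powr' continuous_on_subset[OF cont])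
        (auto simp: K_def)
    then obtain y where y: "y \<in> K" "\<And>z. z \<in> K \<Longrightarrow> (u z - 1) * d z powr \<alpha> \<le> (u y - 1) * d y powr \<alpha>"
      using continuous_attains_sup[OF K] by blast
    define M where "M = (u y - 1) * d y powr \<alpha>"
    have dx: "d x = R\<^sup>2" by (simp add: d_def)
    have Mx: "M \<ge> (u x - 1) * (R\<^sup>2) powr \<alpha>"
      using y(2)[of x] x R closure_subset[of S] by (auto simp: M_def K_def dx)
    then have Mpos: "M > 0" using ux R
      by (smt (verit) mult_pos_pos powr_gt_zero zero_less_power)
    have dy: "d y > 0" using Mpos dK[OF y(1)] by (cases "d y = 0") (auto simp: M_def)
    have uy: "u y > 1" using Mpos dy by (auto simp: M_def zero_less_mult_iff)
    \<comment> \<open>A positive maximum rules out both the sphere, where \<open>d\<close> is zero,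
      and the frontier, where \<open>u\<close> is at most 1.\<close>
    have yS: "y \<in> S" using y(1) bdry uy S by (force simp: K_def frontier_def interior_open)
    have yR: "norm (y - x) < R" using dy R by (simp add: d_def power_less_imp_less_base)
    define F where "F = (\<lambda>s. M * (R\<^sup>2 - s) powr (- \<alpha>))"
    define F' where "F' = (\<lambda>s. M * \<alpha> * (R\<^sup>2 - s) powr (- \<alpha> - 1))"
    define F'' where "F'' = M * \<alpha> * (\<alpha> + 1) * d y powr (- \<alpha> - 2)"
    have pd: "((\<lambda>s. (R\<^sup>2 - s) powr a) has_real_derivative a * (R\<^sup>2 - s) powr (a - 1) * - 1) (at s)"
      if "s < R\<^sup>2" for a s
      by (rule DERIV_chain2[OF has_real_derivative_powr])
        (use that in \<open>auto intro!: derivative_eq_intros\<close>)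
    have Fd: "(F has_real_derivative F' s) (at s)" if "s < R\<^sup>2" for s
      using DERIV_cmult[OF pd[OF that, of "- \<alpha>"], of M] by (simp add: F_def F'_def mult_ac)
    have "\<forall>\<^sub>F s in nhds ((norm (y - x))\<^sup>2). s \<in> {..<R\<^sup>2}"
      using dy by (intro eventually_nhds_in_open) (auto simp: d_def)
    then have F1: "\<forall>\<^sub>F s in nhds ((norm (y - x))\<^sup>2). (F has_real_derivative F' s) (at s)"
      by eventually_elim (use Fd in auto)
    have F2: "(F' has_real_derivative F'') (at ((norm (y - x))\<^sup>2))"
    proof -
      have "M * \<alpha> * ((- \<alpha> - 1) * (R\<^sup>2 - (norm (y - x))\<^sup>2) powr ((- \<alpha> - 1) - 1) * - 1) = F''"
        by (simp add: F''_def d_def algebra_simps)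
      then show ?thesis
        using DERIV_cmult[OF pd[of "(norm (y - x))\<^sup>2" "- \<alpha> - 1"], of "M * \<alpha>"] dy
        unfolding F'_def by (simp add: d_def)
    qed
    have T1: "\<forall>\<^sub>F s in nhds (u y). ((\<lambda>s. s) has_real_derivative 1) (at s)"
      by auto
    have T2: "((\<lambda>s::real. 1) has_real_derivative 0) (at (u y))" by simp
    have mx: "\<forall>\<^sub>F z in nhds y. u z - F ((norm (z - x))\<^sup>2) \<le> u y - F ((norm (y - x))\<^sup>2)"
    proof -
      have "\<forall>\<^sub>F z in nhds y. z \<in> S \<inter> ball x R"
        using S yS yR by (intro eventually_nhds_in_open) (auto simp: dist_norm norm_minus_commute)
      then show ?thesis
      proof eventually_elim
        case (elim z)
        then have zK: "z \<in> K" using closure_subset[of S] by (auto simp: K_def)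
        have dz: "d z > 0" using elim
          by (auto simp: d_def dist_norm norm_minus_commute intro!: power_strict_mono)
        have "u z - 1 \<le> M * d z powr (- \<alpha>)"
          using y(2)[OF zK] dz by (simp add: M_def powr_minus field_simps)
        moreover have "u y - 1 = M * d y powr (- \<alpha>)"
          using dy by (simp add: M_def powr_minus field_simps)
        ultimately show ?case by (simp add: F_def d_def)
      qed
    qed
    have qR: "(norm (y - x))\<^sup>2 \<le> R\<^sup>2" using dy by (simp add: d_def)
    have dR: "d y \<le> R\<^sup>2" by (simp add: d_def)
    \<comment> \<open>The \<open>F'\<close> term has one negative power of \<open>d\<close> fewer
      than \<open>F''\<close>; the spare factor \<open>d y\<close> is bounded by
      \<open>R\<^sup>2\<close>, so both fit under the constant \<open>C\<close>.\<close>
    have P: "d y powr (- \<alpha> - 1) = d y * d y powr (- \<alpha> - 2)"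
    proof -
      have e: "- \<alpha> - 1 = 1 + (- \<alpha> - 2)" by simp
      show ?thesis unfolding e powr_add using dy by simp
    qed
    have "laplacian u y \<le> 4 * (norm (y - x))\<^sup>2 * F'' + 2 * real DIM('a) * F' ((norm (y - x))\<^sup>2)"
      using touching(1)[OF S yS u T1 T2 F1 F2 mx] by simp
    also have "F' ((norm (y - x))\<^sup>2) = M * \<alpha> * (d y * d y powr (- \<alpha> - 2))"
      using P by (simp add: F'_def d_def)
    also have "4 * (norm (y - x))\<^sup>2 * F'' + 2 * real DIM('a) * (M * \<alpha> * (d y * d y powr (- \<alpha> - 2)))
        \<le> 4 * R\<^sup>2 * F'' + 2 * real DIM('a) * (M * \<alpha> * (R\<^sup>2 * d y powr (- \<alpha> - 2)))"
      using qR dR Mpos \<alpha> unfolding F''_def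
      by (intro add_mono mult_left_mono mult_right_mono) auto
    also have "\<dots> = M * R\<^sup>2 * C * d y powr (- \<alpha> - 2)"
      by (simp add: F''_def C_def algebra_simps)
    finally have up: "laplacian u y \<le> M * R\<^sup>2 * C * d y powr (- \<alpha> - 2)" .
    have "u y - 1 = M * d y powr (- \<alpha>)"
      using dy by (simp add: M_def powr_minus field_simps)
    then have "(u y - 1) powr p = M powr p * d y powr (- \<alpha> * p)"
      using Mpos by (simp add: powr_mult powr_powr)
    also have "- \<alpha> * p = - \<alpha> - 2" using \<alpha> by simp
    also have "M powr p = M * M powr (p - 1)" using Mpos by (simp add: powr_diff)
    finally have "c * (M * M powr (p - 1) * d y powr (- \<alpha> - 2)) \<le> M * R\<^sup>2 * C * d y powr (- \<alpha> - 2)"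
      using lap yS uy up by force
    then have "(M * d y powr (- \<alpha> - 2)) * (c * M powr (p - 1)) \<le> (M * d y powr (- \<alpha> - 2)) * (R\<^sup>2 * C)"
      by (simp add: mult_ac)
    then have cM: "c * M powr (p - 1) \<le> R\<^sup>2 * C"
      using Mpos dy by (subst (asm) mult_le_cancel_left_pos) auto
    \<comment> \<open>At the centre \<open>d\<close> equals \<open>R\<^sup>2\<close>, and
      \<open>\<alpha> * (p - 1) = 2\<close> gives the factor \<open>R^4\<close>, one
      \<open>R\<^sup>2\<close> more than the upper bound contains.\<close>
    have "((u x - 1) * (R\<^sup>2) powr \<alpha>) powr (p - 1) \<le> M powr (p - 1)"
      using Mx ux pc by (intro powr_mono2) auto
    also have "((u x - 1) * (R\<^sup>2) powr \<alpha>) powr (p - 1) = (u x - 1) powr (p - 1) * (R\<^sup>2)\<^sup>2"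
    proof -
      have "\<alpha> * (p - 1) = 2" using \<alpha> by (simp add: algebra_simps)
      then show ?thesis using ux R by (simp add: powr_mult powr_powr)
    qed
    finally have "c * ((u x - 1) powr (p - 1) * (R\<^sup>2)\<^sup>2) \<le> R\<^sup>2 * C"
      using cM pc(2) by (smt (verit) mult_left_mono)
    then show ?thesis using R by (simp add: field_simps power2_eq_square)
  qed
  define e where "e = (u x - 1) powr (p - 1) * c"
  have e: "e > 0" using ux pc by (simp add: e_def)
  \<comment> \<open>This radius makes the right-hand side equal to \<open>e / 2\<close>.\<close>
  have "e \<le> C / (sqrt (2 * C / e))\<^sup>2"
    using bound[of "sqrt (2 * C / e)"] e C by (simp add: e_def)
  then show False using e C by simp
qed

text \<open>The barriers are \<open>s (1 - |y - x|\<^sup>2 / D\<^sup>2)\<^sup>2\<close>, \<open>0 < s \<le> m\<close>: for large \<open>D\<close> the function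
  \<open>(1 - |y|\<^sup>2 / D\<^sup>2)\<^sup>2\<close> plays the role of a first Dirichlet eigenfunction with eigenvalue below \<open>\<delta>\<close>.\<close>
lemma interior_lower_bound:
  fixes u :: "'a::euclidean_space \<Rightarrow> real"
  assumes S: "open S" and u: "C_k_on 2 S u" and upos: "\<forall>x\<in>S. u x > 0"
    and lap: "\<forall>x\<in>S. u x \<le> m \<longrightarrow> laplacian u x \<le> - \<delta> * u x"
    and D: "D > 0" "real DIM('a) * (real DIM('a) + 2)\<^sup>2 < \<delta> * D\<^sup>2"
    and xD: "cball x D \<subseteq> S"
  shows "u x \<ge> m"
proof (rule ccontr)
  assume "\<not> u x \<ge> m"
  then have ux: "u x < m" by simp
  have cu: "continuous_on S u"
    using u by (auto simp: numeral_2_eq_2 intro!: continuous_at_imp_continuous_on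
        differentiable_imp_continuous_within)
  let ?n = "real DIM('a)"
  define d where "d = (\<lambda>y. 1 - (norm (y - x))\<^sup>2 / D\<^sup>2)"
  have cuK: "continuous_on (cball x D) u" using cu xD by (rule continuous_on_subset)
  have dK: "d y \<ge> 0" if "y \<in> cball x D" for y
    using that D by (auto simp: d_def dist_norm norm_minus_commute divide_le_eq intro: power_mono)
  \<comment> \<open>The largest admissible \<open>s\<close> is \<open>1 / max (d\<^sup>2 / u)\<close>.\<close>
  have "continuous_on (cball x D) (\<lambda>y. (d y)\<^sup>2 / u y)"
    unfolding d_def using D upos xD by (intro continuous_intros cuK) force+
  then obtain y where y: "y \<in> cball x D" "\<And>z. z \<in> cball x D \<Longrightarrow> (d z)\<^sup>2 / u z \<le> (d y)\<^sup>2 / u y"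
    using continuous_attains_sup[of "cball x D" "\<lambda>y. (d y)\<^sup>2 / u y"] D(1) by auto
  have yS: "y \<in> S" using y xD by auto
  have uy: "u y > 0" using upos yS by auto
  have xS: "x \<in> S" using xD D by auto
  have ux0: "u x > 0" using upos xS by auto
  have dx: "d x = 1" by (simp add: d_def)
  have yx: "1 / u x \<le> (d y)\<^sup>2 / u y" using y(2)[of x] D by (simp add: dx)
  then have "d y \<noteq> 0" using ux0 uy by (auto simp: field_simps)
  then have dy: "d y > 0" using dK[OF y(1)] by simp
  define s where "s = u y / (d y)\<^sup>2"
  have s0: "s > 0" using uy dy by (simp add: s_def)
  have sx: "s \<le> u x" using yx uy dy ux0 by (simp add: s_def field_simps)
  have uys: "u y = s * (d y)\<^sup>2" using dy by (simp add: s_def)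
  have dy1: "(d y)\<^sup>2 \<le> 1" using dy by (intro power_le_one) (auto simp: d_def)
  \<comment> \<open>The contact value lies in the range of the differential inequality:
    \<open>u y \<le> s \<le> u x < m\<close>, the middle step because
    \<open>d x = 1\<close>.\<close>
  have uym: "u y \<le> m"
    using mult_left_mono[OF dy1 less_imp_le[OF s0]] sx ux unfolding uys by linarith
  have yR: "norm (y - x) < D" using dy D by (auto simp: d_def divide_less_eq intro: power_less_imp_less_base)
  \<comment> \<open>\<open>F\<close> is minus the barrier: the minimum of \<open>u\<close> minus the
    barrier is treated as a maximum, with \<open>T s = - s\<close>.\<close>
  define F where "F = (\<lambda>q. - (s * (1 - q / D\<^sup>2)\<^sup>2))"
  define F' where "F' = (\<lambda>q. 2 * s * (1 - q / D\<^sup>2) / D\<^sup>2)"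
  define F'' where "F'' = - 2 * s / D\<^sup>2 / D\<^sup>2"
  have F1: "\<forall>\<^sub>F q in nhds ((norm (y - x))\<^sup>2). (F has_real_derivative F' q) (at q)"
    unfolding F_def F'_def
    by (intro always_eventually allI) (use D(1) in \<open>auto intro!: derivative_eq_intros simp: power2_eq_square power4_eq_xxxx field_simps\<close>)
  have F2: "(F' has_real_derivative F'') (at ((norm (y - x))\<^sup>2))"
    unfolding F'_def F''_def using D(1)
    by (auto intro!: derivative_eq_intros simp: field_simps eval_nat_numeral)
  have T1: "\<forall>\<^sub>F s in nhds (u y). ((\<lambda>s. - s) has_real_derivative - 1) (at s)"
    by (intro always_eventually allI) (auto intro!: derivative_eq_intros)
  have T2: "((\<lambda>s::real. - 1) has_real_derivative 0) (at (u y))" by simp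
  have mx: "\<forall>\<^sub>F z in nhds y. - u z - F ((norm (z - x))\<^sup>2) \<le> - u y - F ((norm (y - x))\<^sup>2)"
  proof -
    have "\<forall>\<^sub>F z in nhds y. z \<in> ball x D"
      using yR by (intro eventually_nhds_in_open) (auto simp: dist_norm norm_minus_commute)
    then show ?thesis
    proof eventually_elim
      case (elim z)
      then have "z \<in> S" using xD by auto
      then have "u z > 0" "(d z)\<^sup>2 / u z \<le> (d y)\<^sup>2 / u y" using y(2)[of z] upos elim by auto
      then have "s * (d z)\<^sup>2 \<le> u z" using uy dy by (simp add: s_def field_simps)
      then show ?case using uys by (simp add: F_def d_def)
    qed
  qed
  define q where "q = (norm (y - x))\<^sup>2 / D\<^sup>2"
  have qd: "q = 1 - d y" by (simp add: q_def d_def)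
  have "- laplacian u y \<le> 4 * (norm (y - x))\<^sup>2 * F'' + 2 * ?n * F' ((norm (y - x))\<^sup>2)"
    using touching(1)[OF S yS u T1 T2 F1 F2 mx] by simp
  also have "\<dots> = s * (4 * ?n * d y - 8 * q) / D\<^sup>2"
    using D by (simp add: F''_def F'_def q_def d_def field_simps)
  finally have "\<delta> * (s * (d y)\<^sup>2) \<le> s * (4 * ?n * d y - 8 * q) / D\<^sup>2"
    using lap yS uym by (force simp: uys)
  then have "s * (\<delta> * D\<^sup>2 * (d y)\<^sup>2) \<le> s * (4 * ?n * d y - 8 * q)"
    using D by (simp add: field_simps)
  then have *: "\<delta> * D\<^sup>2 * (d y)\<^sup>2 \<le> 4 * ?n * d y - 8 * (1 - d y)"
    using s0 by (simp add: qd)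
  \<comment> \<open>With \<open>a = (?n + 2) * d y\<close> the contradiction is the chain \<open>4 *
    (a - 2) \<le> a\<^sup>2 \<le> ?n * a\<^sup>2 < \<delta> * D\<^sup>2 * (d y)\<^sup>2\<close>,
    which explains the size required of \<open>D\<close>.\<close>
  have "?n * (?n + 2)\<^sup>2 * (d y)\<^sup>2 < \<delta> * D\<^sup>2 * (d y)\<^sup>2"
    using D(2) dy by (intro mult_strict_right_mono) auto
  moreover have "?n * ((?n + 2) * d y)\<^sup>2 = ?n * (?n + 2)\<^sup>2 * (d y)\<^sup>2"
    by (simp add: power_mult_distrib)
  moreover have "4 * ((?n + 2) * d y - 2) = 4 * ?n * d y - 8 * (1 - d y)"
    by (simp add: algebra_simps)
  moreover have "((?n + 2) * d y)\<^sup>2 \<le> ?n * ((?n + 2) * d y)\<^sup>2"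
    using mult_right_mono[of 1 ?n "((?n + 2) * d y)\<^sup>2"] by simp
  moreover have "4 * ((?n + 2) * d y - 2) \<le> ((?n + 2) * d y)\<^sup>2"
    using zero_le_power2[of "(?n + 2) * d y - 2"] by (simp add: power2_eq_square algebra_simps)
  ultimately show False using * by linarith
qed

subsection \<open>Boundary behaviour on an epigraph\<close>

text \<open>On the frontier \<open>Du\<close> is only a continuous extension. The mean value theorem
  writes the difference quotient as \<open>Du\<close> at an interior point of the segment, and
  continuity of \<open>Du\<close> up to \<open>z\<close> gives the limit.\<close>

lemma boundary_directional_derivative:
  fixes u :: "'a::euclidean_space \<Rightarrow> real"
  assumes C1: "C1_closure S u Du" and z: "z \<in> closure S"
    and seg: "\<forall>\<^sub>F t in at_right 0. z + t *\<^sub>R e \<in> S"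
  shows "((\<lambda>t. (u (z + t *\<^sub>R e) - u z) / t) \<longlongrightarrow> Du z \<bullet> e) (at_right 0)"
proof (rule tendstoI)
  fix \<epsilon> :: real assume \<epsilon>: "\<epsilon> > 0"
  obtain a where a: "a > 0" "\<And>t. 0 < t \<Longrightarrow> t < a \<Longrightarrow> z + t *\<^sub>R e \<in> S"
    using seg unfolding eventually_at_right_field by auto
  have cl: "z + t *\<^sub>R e \<in> closure S" if "0 \<le> t" "t < a" for t
    using a(2)[of t] that z closure_subset[of S] by (cases "t = 0") auto
  have line: "continuous_on {0..<a} (\<lambda>t. z + t *\<^sub>R e)" by (intro continuous_intros)
  have cu: "continuous_on {0..<a} (\<lambda>t. u (z + t *\<^sub>R e))"
    using C1 cl by (auto simp: C1_closure_def intro!: continuous_on_compose2[OF _ line])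
  have "continuous_on {0..<a} (\<lambda>t. Du (z + t *\<^sub>R e) \<bullet> e)"
    using C1 cl
    by (auto simp: C1_closure_def intro!: continuous_on_inner continuous_on_compose2[OF _ line] continuous_on_const)
  then obtain d where d: "d > 0" "\<And>t. t \<in> {0..<a} \<Longrightarrow> dist t 0 < d \<Longrightarrow>
      dist (Du (z + t *\<^sub>R e) \<bullet> e) (Du (z + 0 *\<^sub>R e) \<bullet> e) < \<epsilon>"
    unfolding continuous_on_iff using \<epsilon> a(1) by (metis atLeastLessThan_iff order_refl)
  have der: "((\<lambda>t. u (z + t *\<^sub>R e)) has_real_derivative Du (z + t *\<^sub>R e) \<bullet> e) (at t)"
    if "0 < t" "t < a" for t
  proof -
    have D: "(u has_derivative (\<lambda>h. h \<bullet> Du (z + t *\<^sub>R e))) (at (z + t *\<^sub>R e))"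
      using C1 a(2)[OF that] by (simp add: C1_closure_def gderiv_def)
    have "((\<lambda>t. z + t *\<^sub>R e) has_derivative (\<lambda>h. h *\<^sub>R e)) (at t)"
      by (auto intro!: derivative_eq_intros)
    from has_derivative_compose[OF this D] show ?thesis
      by (simp add: has_field_derivative_def mult_commute_abs inner_commute)
  qed
  show "\<forall>\<^sub>F t in at_right 0. dist ((u (z + t *\<^sub>R e) - u z) / t) (Du z \<bullet> e) < \<epsilon>"
    unfolding eventually_at_right_field
  proof (intro exI[of _ "min a d"] conjI allI impI)
    show "0 < min a d" using a d by simp
    fix t assume t: "0 < t" "t < min a d"
    have "\<exists>\<xi>>0. \<xi> < t \<and> u (z + t *\<^sub>R e) - u (z + 0 *\<^sub>R e) = (t - 0) * (Du (z + \<xi> *\<^sub>R e) \<bullet> e)"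
    proof -
      have "\<exists>l \<xi>. 0 < \<xi> \<and> \<xi> < t \<and> DERIV (\<lambda>t. u (z + t *\<^sub>R e)) \<xi> :> l \<and>
          u (z + t *\<^sub>R e) - u (z + 0 *\<^sub>R e) = (t - 0) * l"
      proof (rule MVT)
        show "continuous_on {0..t} (\<lambda>t. u (z + t *\<^sub>R e))"
          using t by (auto intro: continuous_on_subset[OF cu])
        show "(\<lambda>t. u (z + t *\<^sub>R e)) differentiable (at s)" if "0 < s" "s < t" for s
          using der[of s] that t by (auto simp: real_differentiable_def)
      qed (use t in auto)
      then show ?thesis using der t by (metis DERIV_unique less_trans min_less_iff_conj)
    qed
    then obtain \<xi> where \<xi>: "0 < \<xi>" "\<xi> < t" "u (z + t *\<^sub>R e) - u z = t * (Du (z + \<xi> *\<^sub>R e) \<bullet> e)"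
      by auto
    then show "dist ((u (z + t *\<^sub>R e) - u z) / t) (Du z \<bullet> e) < \<epsilon>"
      using d(2)[of \<xi>] t by (simp add: dist_real_def)
  qed
qed

text \<open>Turns a comparison of \<open>T u\<close> with a distance into a bound on the boundary
  gradient. It is a chain rule with a one-sided outer derivative: positivity of \<open>u\<close>
  keeps its values on the correct side of 0.\<close>

lemma boundary_profile_derivative:
  fixes u :: "'a::euclidean_space \<Rightarrow> real"
  assumes C1: "C1_closure S u Du" and z: "z \<in> closure S" "u z = 0"
    and upos: "\<forall>x\<in>S. u x > 0"
    and seg: "\<forall>\<^sub>F t in at_right 0. z + t *\<^sub>R e \<in> S"
    and T: "(T has_real_derivative T') (at 0 within {0..b})" "T 0 = 0" "b > 0"
  shows "((\<lambda>t. T (u (z + t *\<^sub>R e)) / t) \<longlongrightarrow> T' * (Du z \<bullet> e)) (at_right 0)"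
proof -
  note L = boundary_directional_derivative[OF C1 z(1) seg]
  have "((\<lambda>t. (u (z + t *\<^sub>R e) - u z) / t * t) \<longlongrightarrow> (Du z \<bullet> e) * 0) (at_right 0)"
    by (intro tendsto_mult L tendsto_ident_at)
  then have u0: "((\<lambda>t. u (z + t *\<^sub>R e)) \<longlongrightarrow> 0) (at_right 0)"
    unfolding z(2) mult_zero_right
    by (rule Lim_transform_eventually) (auto simp: eventually_at_right_field intro: exI[of _ 1])
  have ub: "\<forall>\<^sub>F t in at_right 0. u (z + t *\<^sub>R e) < b"
    using u0 T(3) by (rule order_tendstoD)
  have up: "\<forall>\<^sub>F t in at_right 0. u (z + t *\<^sub>R e) > 0"
    using seg upos by (auto elim: eventually_mono)
  have "filterlim (\<lambda>t. u (z + t *\<^sub>R e)) (at 0 within {0..b}) (at_right 0)"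
    unfolding filterlim_at using u0 ub up
    by (auto elim: eventually_elim2)
  moreover have "((\<lambda>s. (T s - T 0) / (s - 0)) \<longlongrightarrow> T') (at 0 within {0..b})"
    using T(1) by (simp add: has_field_derivative_iff)
  ultimately have "((\<lambda>t. (T (u (z + t *\<^sub>R e)) - T 0) / (u (z + t *\<^sub>R e) - 0)) \<longlongrightarrow> T') (at_right 0)"
    by (rule filterlim_compose[rotated])
  from tendsto_mult[OF this L]
  show ?thesis
  proof (rule Lim_transform_eventually)
    show "\<forall>\<^sub>F t in at_right 0. (T (u (z + t *\<^sub>R e)) - T 0) / (u (z + t *\<^sub>R e) - 0) *
        ((u (z + t *\<^sub>R e) - u z) / t) = T (u (z + t *\<^sub>R e)) / t"
      using up by eventually_elim (simp add: z(2) T(2))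
  qed
qed

text \<open>The gradient is continuous up to the boundary, so the tangential derivative of \<open>u\<close> on the
  graph is the limit of derivatives along the vertically shifted graphs.\<close>
lemma gradient_normal_strict_epigraph:
  fixes \<phi> :: "'a::euclidean_space \<Rightarrow> real" and u :: "'a \<times> real \<Rightarrow> real"
  assumes phi: "C_k_on 1 UNIV \<phi>"
    and C1: "C1_closure (strict_epigraph \<phi>) u Du"
    and u0: "\<forall>x\<in>frontier (strict_epigraph \<phi>). u x = 0"
    and z: "z \<in> frontier (strict_epigraph \<phi>)"
    and \<nu>: "outer_unit_normal (strict_epigraph \<phi>) z \<nu>"
  shows "norm (Du z) = \<bar>Du z \<bullet> \<nu>\<bar>"
proof -
  let ?S = "strict_epigraph \<phi>"
  let ?\<phi>' = "\<lambda>x. frechet_derivative \<phi> (at x)"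
  have dphi: "(\<phi> has_derivative ?\<phi>' x) (at x)" for x
    using phi frechet_derivative_works by auto
  have cphi: "continuous_on UNIV \<phi>"
    by (intro continuous_at_imp_continuous_on ballI has_derivative_continuous[OF dphi])
  have fr: "frontier ?S = {p. snd p = \<phi> (fst p)}" by (rule frontier_strict_epigraph[OF cphi])
  have inS: "(y, \<phi> y + s) \<in> closure ?S" if "s \<ge> 0" for y s
  proof (cases "s = 0")
    case True
    then have "(y, \<phi> y + s) \<in> frontier ?S" by (simp add: fr)
    then show ?thesis by (simp add: frontier_def)
  next
    case False
    then have "(y, \<phi> y + s) \<in> ?S" using that by (simp add: strict_epigraph_def)
    then show ?thesis using closure_subset by blast
  qed
  obtain x where zx: "z = (x, \<phi> x)" using z by (cases z) (auto simp: fr)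
  have le0: "Du z \<bullet> (h, ?\<phi>' x h) \<le> 0" for h
  proof (rule ccontr)
    assume "\<not> Du z \<bullet> (h, ?\<phi>' x h) \<le> 0"
    then have P: "Du z \<bullet> (h, ?\<phi>' x h) > 0" (is "?P > 0") by simp
    \<comment> \<open>\<open>Q (s, t)\<close> runs along the graph shifted up by \<open>s\<close>,
      over the line in direction \<open>h\<close>; \<open>\<Psi>\<close> is the
      \<open>t\<close>-derivative of \<open>u\<close> along it, continuous down to
      \<open>s = 0\<close>.\<close>
    define Q where "Q = (\<lambda>(s, t). (x + t *\<^sub>R h, \<phi> (x + t *\<^sub>R h) + s))"
    define \<Psi> where "\<Psi> = (\<lambda>(s, t). Du (Q (s, t)) \<bullet> (h, ?\<phi>' (x + t *\<^sub>R h) h))"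
    have line: "continuous_on A (\<lambda>p::real \<times> real. x + snd p *\<^sub>R h)" for A
      by (intro continuous_intros)
    have cQ: "continuous_on ({0..} \<times> UNIV) Q"
      unfolding Q_def case_prod_beta
      by (intro continuous_intros continuous_on_compose2[OF cphi line]) auto
    have Qc: "Q p \<in> closure ?S" if "p \<in> {0..} \<times> UNIV" for p
      using that inS by (auto simp: Q_def)
    have "continuous_on UNIV (\<lambda>y. ?\<phi>' y h)" using phi by simp
    from continuous_on_compose2[OF this line]
    have "continuous_on ({0..} \<times> UNIV) \<Psi>"
      using C1 Qc unfolding \<Psi>_def case_prod_beta prod.collapse
      by (intro continuous_on_inner continuous_on_Pair continuous_on_const
          continuous_on_compose2[OF _ cQ]) (auto simp: C1_closure_def)
    moreover have "\<Psi> (0, 0) = ?P" by (simp add: \<Psi>_def Q_def zx)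
    ultimately obtain d where d: "d > 0" "\<And>p. p \<in> {0..} \<times> UNIV \<Longrightarrow> dist p (0, 0) < d \<Longrightarrow> dist (\<Psi> p) ?P < ?P / 2"
      unfolding continuous_on_iff using P
      by (metis (no_types, lifting) SigmaI UNIV_I atLeast_iff half_gt_zero order_refl)
    define \<tau> where "\<tau> = d / 2"
    have \<tau>: "\<tau> > 0" using d by (simp add: \<tau>_def)
    have der: "((\<lambda>t. u (Q (s, t))) has_real_derivative \<Psi> (s, t)) (at t)" if "s > 0" for s t
    proof -
      have "Q (s, t) \<in> ?S" using that by (simp add: Q_def strict_epigraph_def)
      then have D: "(u has_derivative (\<lambda>v. v \<bullet> Du (Q (s, t)))) (at (Q (s, t)))"
        using C1 by (simp add: C1_closure_def gderiv_def)
      have l: "((\<lambda>t. x + t *\<^sub>R h) has_derivative (\<lambda>r. r *\<^sub>R h)) (at t)"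
        by (auto intro!: derivative_eq_intros)
      have "((\<lambda>t. \<phi> (x + t *\<^sub>R h)) has_derivative (\<lambda>r. ?\<phi>' (x + t *\<^sub>R h) (r *\<^sub>R h))) (at t)"
        by (rule has_derivative_compose[OF l dphi])
      then have "((\<lambda>t. Q (s, t)) has_derivative (\<lambda>r. (r *\<^sub>R h, ?\<phi>' (x + t *\<^sub>R h) (r *\<^sub>R h)))) (at t)"
        unfolding Q_def by (auto intro!: derivative_eq_intros has_derivative_Pair l)
      from has_derivative_compose[OF this D]
      have "((\<lambda>t. u (Q (s, t))) has_derivative
          (\<lambda>r. (r *\<^sub>R h, ?\<phi>' (x + t *\<^sub>R h) (r *\<^sub>R h)) \<bullet> Du (Q (s, t)))) (at t)" .
      moreover have "(r *\<^sub>R h, ?\<phi>' (x + t *\<^sub>R h) (r *\<^sub>R h)) \<bullet> Du (Q (s, t)) = \<Psi> (s, t) * r" for r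
      proof -
        have "(r *\<^sub>R h, ?\<phi>' (x + t *\<^sub>R h) (r *\<^sub>R h)) = r *\<^sub>R (h, ?\<phi>' (x + t *\<^sub>R h) h)"
          using linear_scale[OF has_derivative_linear[OF dphi]] by simp
        then show ?thesis
          by (simp add: \<Psi>_def inner_commute mult.commute del: scaleR_Pair)
      qed
      ultimately show ?thesis by (simp add: has_field_derivative_def)
    qed
    \<comment> \<open>A positive tangential derivative forces a gain along the shifted graphs that
      is uniform in \<open>s\<close>, whereas both end values tend to 0 as \<open>s\<close>
      does.\<close>
    have grow: "u (Q (s, \<tau>)) - u (Q (s, 0)) \<ge> \<tau> * (?P / 2)" if s: "0 < s" "s < d / 2" for s
    proof -
      obtain \<xi> where \<xi>: "0 < \<xi>" "\<xi> < \<tau>" "u (Q (s, \<tau>)) - u (Q (s, 0)) = (\<tau> - 0) * \<Psi> (s, \<xi>)"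
        using MVT2[OF \<tau>, of "\<lambda>t. u (Q (s, t))" "\<lambda>t. \<Psi> (s, t)"] der[OF s(1)] by blast
      have "dist (s, \<xi>) (0, 0) \<le> \<bar>s\<bar> + \<bar>\<xi>\<bar>"
        using norm_Pair_le[of s \<xi>] by (simp add: dist_norm)
      then have "dist (\<Psi> (s, \<xi>)) ?P < ?P / 2" using s \<xi> by (intro d) (auto simp: \<tau>_def)
      then have "\<Psi> (s, \<xi>) \<ge> ?P / 2" unfolding dist_real_def by linarith
      then show ?thesis using \<xi>(3) \<tau> by (simp add: mult_left_mono)
    qed
    have cl: "continuous_on {0..} (\<lambda>s. u (Q (s, t)))" for t
    proof -
      have "continuous_on ({0..} \<times> UNIV) (\<lambda>p. u (Q p))"
        using C1 Qc by (intro continuous_on_compose2[OF _ cQ]) (auto simp: C1_closure_def)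
      then show ?thesis
        by (rule continuous_on_compose2) (auto intro!: continuous_intros)
    qed
    have lim: "((\<lambda>s. u (Q (s, t))) \<longlongrightarrow> 0) (at_right 0)" for t
    proof -
      have "Q (0, t) \<in> frontier ?S" by (simp add: Q_def fr)
      then have "u (Q (0, t)) = 0" using u0 by blast
      moreover have "((\<lambda>s. u (Q (s, t))) \<longlongrightarrow> u (Q (0, t))) (at 0 within {0..})"
        using cl[of t] unfolding continuous_on_def by auto
      ultimately have "((\<lambda>s. u (Q (s, t))) \<longlongrightarrow> 0) (at 0 within {0..})" by simp
      then show ?thesis by (rule tendsto_within_subset) auto
    qed
    have "((\<lambda>s. u (Q (s, \<tau>)) - u (Q (s, 0))) \<longlongrightarrow> 0 - 0) (at_right 0)"
      by (intro tendsto_diff lim)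
    moreover have "\<forall>\<^sub>F s in at_right 0. \<tau> * (?P / 2) \<le> u (Q (s, \<tau>)) - u (Q (s, 0))"
      using grow d(1) by (auto simp: eventually_at_right_field intro!: exI[of _ "d / 2"])
    ultimately have "\<tau> * (?P / 2) \<le> 0 - 0"
      by (rule tendsto_lowerbound) simp
    then show False using \<tau> P by (simp add: mult_le_0_iff)
  qed
  have lin: "linear (?\<phi>' x)" using dphi has_derivative_linear by blast
  define g where "g = adjoint (?\<phi>' x) 1"
  have g: "?\<phi>' x h = h \<bullet> g" for h using adjoint_works[OF lin, of h 1] by (simp add: g_def)
  have G: "GDERIV \<phi> x :> g" using dphi[of x] by (simp add: gderiv_def flip: g)
  define r where "r = sqrt (1 + (norm g)\<^sup>2)"
  have r: "r > 0" by (simp add: r_def add_pos_nonneg)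
  have \<nu>e: "\<nu> = (g, -1) /\<^sub>R r"
    using \<nu> outer_unit_normal_strict_epigraph[OF G cphi] by (simp add: zx r_def)
  obtain a b where ab: "Du z = (a, b)" by (cases "Du z")
  \<comment> \<open>Taking \<open>h\<close> and \<open>- h\<close> makes all tangential derivatives
    vanish, so \<open>Du z\<close> is a multiple of the normal.\<close>
  have "h \<bullet> (a + b *\<^sub>R g) = 0" for h
    using le0[of h] le0[of "- h"] by (simp add: ab g inner_commute algebra_simps)
  then have "a + b *\<^sub>R g = 0" using inner_eq_zero_iff by blast
  then have "a = - (b *\<^sub>R g)" by (simp add: eq_neg_iff_add_eq_0)
  then have D: "Du z = (- b * r) *\<^sub>R \<nu>" using r by (simp add: ab \<nu>e)
  have "norm \<nu> = 1" using \<nu> by (simp add: outer_unit_normal_def)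
  then show ?thesis by (simp add: D dot_square_norm)
qed

text \<open>A ball centred on the vertical axis is lowered until its lower hemisphere first meets
  the graph; the contact height \<open>t\<close> is a maximum over a compact ball. The argument is
  global, so the radius is not limited by the curvature of the graph.\<close>

lemma strict_epigraph_interior_ball:
  fixes \<phi> :: "'a::euclidean_space \<Rightarrow> real"
  assumes c: "continuous_on UNIV \<phi>" and R: "R > 0"
  obtains c z where "z \<in> frontier (strict_epigraph \<phi>)" "norm (z - c) = R" "ball c R \<subseteq> strict_epigraph \<phi>"
proof -
  let ?f = "\<lambda>x. \<phi> x + sqrt (R\<^sup>2 - (norm x)\<^sup>2)"
  have "continuous_on (cball 0 R) ?f"
    by (intro continuous_intros continuous_on_subset[OF c]) auto
  then obtain y where y: "y \<in> cball 0 R" "\<And>x. x \<in> cball 0 R \<Longrightarrow> ?f x \<le> ?f y"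
    using continuous_attains_sup[of "cball 0 R" ?f] R by auto
  define t where "t = ?f y"
  have yR: "(norm y)\<^sup>2 \<le> R\<^sup>2" using y(1) by (intro power_mono) auto
  show thesis
  proof (rule that[of "(y, \<phi> y)" "(0, t)"])
    show "(y, \<phi> y) \<in> frontier (strict_epigraph \<phi>)" by (simp add: frontier_strict_epigraph[OF c])
    show "norm ((y, \<phi> y) - (0, t)) = R" using yR R by (simp add: norm_Pair t_def)
    show "ball (0, t) R \<subseteq> strict_epigraph \<phi>"
    proof
      fix p assume p: "p \<in> ball (0::'a, t) R"
      obtain x s where xs: "p = (x, s)" by (cases p)
      have "sqrt ((norm x)\<^sup>2 + (s - t)\<^sup>2) < R"
        using p by (simp add: xs dist_norm norm_Pair norm_minus_commute power2_commute)
      then have "(norm x)\<^sup>2 + (s - t)\<^sup>2 < R\<^sup>2" using R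
        by (metis abs_of_pos real_sqrt_abs real_sqrt_less_iff)
      then have 1: "(t - s)\<^sup>2 < R\<^sup>2 - (norm x)\<^sup>2" and "(norm x)\<^sup>2 < R\<^sup>2"
        by (auto simp: power2_commute) (smt (verit) zero_le_power2)
      then have "norm x < R" using R by (auto intro: power_less_imp_less_base)
      then have "?f x \<le> t" using y(2)[of x] by (simp add: t_def)
      moreover have "t - s < sqrt (R\<^sup>2 - (norm x)\<^sup>2)" using 1 by (rule real_less_rsqrt)
      ultimately show "p \<in> strict_epigraph \<phi>" by (simp add: strict_epigraph_def xs)
    qed
  qed
qed

text \<open>The mirror image: a ball below the graph is raised until its upper hemisphere makes
  contact.\<close>

lemma strict_epigraph_exterior_ball:
  fixes \<phi> :: "'a::euclidean_space \<Rightarrow> real"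
  assumes c: "continuous_on UNIV \<phi>" and R: "R > 0"
  obtains c z where "z \<in> frontier (strict_epigraph \<phi>)" "norm (z - c) = R" "ball c R \<inter> strict_epigraph \<phi> = {}"
proof -
  let ?f = "\<lambda>x. \<phi> x - sqrt (R\<^sup>2 - (norm x)\<^sup>2)"
  have "continuous_on (cball 0 R) ?f"
    by (intro continuous_intros continuous_on_subset[OF c]) auto
  then obtain y where y: "y \<in> cball 0 R" "\<And>x. x \<in> cball 0 R \<Longrightarrow> ?f y \<le> ?f x"
    using continuous_attains_inf[of "cball 0 R" ?f] R by auto
  define t where "t = ?f y"
  have yR: "(norm y)\<^sup>2 \<le> R\<^sup>2" using y(1) by (intro power_mono) auto
  show thesis
  proof (rule that[of "(y, \<phi> y)" "(0, t)"])
    show "(y, \<phi> y) \<in> frontier (strict_epigraph \<phi>)" by (simp add: frontier_strict_epigraph[OF c])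
    show "norm ((y, \<phi> y) - (0, t)) = R" using yR R by (simp add: norm_Pair t_def)
    have "p \<notin> strict_epigraph \<phi>" if p: "p \<in> ball (0::'a, t) R" for p
    proof -
      obtain x s where xs: "p = (x, s)" by (cases p)
      have "sqrt ((norm x)\<^sup>2 + (s - t)\<^sup>2) < R"
        using p by (simp add: xs dist_norm norm_Pair norm_minus_commute power2_commute)
      then have "(norm x)\<^sup>2 + (s - t)\<^sup>2 < R\<^sup>2" using R
        by (metis abs_of_pos real_sqrt_abs real_sqrt_less_iff)
      then have 1: "(s - t)\<^sup>2 < R\<^sup>2 - (norm x)\<^sup>2" and "(norm x)\<^sup>2 < R\<^sup>2"
        by auto (smt (verit) zero_le_power2)
      then have "norm x < R" using R by (auto intro: power_less_imp_less_base)
      then have "t \<le> ?f x" using y(2)[of x] by (simp add: t_def)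
      moreover have "s - t < sqrt (R\<^sup>2 - (norm x)\<^sup>2)" using 1 by (rule real_less_rsqrt)
      ultimately show ?thesis by (simp add: strict_epigraph_def xs)
    qed
    then show "ball (0, t) R \<inter> strict_epigraph \<phi> = {}" by blast
  qed
qed

subsection \<open>Comparison on tangent balls\<close>

text \<open>The profile equation is separable, so the inverse profile is an antiderivative,
  normalised at 0. The one-sided derivative at 0 is the one seen by \<open>u\<close> at the
  boundary.\<close>

lemma profile_exists:
  fixes G :: "real \<Rightarrow> real"
  assumes G: "continuous_on {0..b} G" "\<forall>s\<in>{0..b}. G s > 0"
  obtains T where "T 0 = 0"
    "\<forall>s\<in>{0..b}. (T has_real_derivative 1 / sqrt (2 * G s)) (at s within {0..b})"
proof -
  have c: "continuous_on {0..b} (\<lambda>s. 1 / sqrt (2 * G s))"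
    using G(2) by (intro continuous_intros G(1)) force
  obtain T where T: "\<forall>s\<in>{0..b}. (T has_vector_derivative 1 / sqrt (2 * G s)) (at s within {0..b})"
    by (rule antiderivative_continuous[OF c]) (rule that, blast)
  show thesis
  proof (rule that[of "\<lambda>s. T s - T 0"])
    show "\<forall>s\<in>{0..b}. ((\<lambda>s. T s - T 0) has_real_derivative 1 / sqrt (2 * G s)) (at s within {0..b})"
      using T by (auto simp: has_real_derivative_iff_has_vector_derivative intro!: derivative_eq_intros)
  qed simp
qed

lemma profile_properties:
  fixes G T :: "real \<Rightarrow> real"
  assumes G: "\<forall>s\<in>{0..b}. G s > 0" and T0: "T 0 = 0"
    and T: "\<forall>s\<in>{0..b}. (T has_real_derivative 1 / sqrt (2 * G s)) (at s within {0..b})"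
  shows "continuous_on {0..b} T"
    and "\<And>s t. 0 \<le> s \<Longrightarrow> s \<le> t \<Longrightarrow> t \<le> b \<Longrightarrow> T s \<le> T t"
    and "\<And>s. 0 \<le> s \<Longrightarrow> s \<le> b \<Longrightarrow> 0 \<le> T s"
    and "\<And>s. 0 < s \<Longrightarrow> s < b \<Longrightarrow> \<forall>\<^sub>F r in nhds s. (T has_real_derivative 1 / sqrt (2 * G r)) (at r)"
proof -
  show c: "continuous_on {0..b} T"
    using T by (intro DERIV_continuous_on[of "{0..b}" T "\<lambda>s. 1 / sqrt (2 * G s)"]) blast
  have d: "(T has_real_derivative 1 / sqrt (2 * G s)) (at s)" if "0 < s" "s < b" for s
    using bspec[OF T, of s] that by (simp add: at_within_Icc_at)
  show mono: "T s \<le> T t" if st: "0 \<le> s" "s \<le> t" "t \<le> b" for s t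
  proof (rule DERIV_nonneg_imp_increasing_open[of s t T])
    show "\<exists>y. (T has_real_derivative y) (at x) \<and> 0 \<le> y" if "s < x" "x < t" for x
      using d[of x] bspec[OF G, of x] that st
      by (intro exI[of _ "1 / sqrt (2 * G x)"]) (auto intro: less_imp_le)
    show "continuous_on {s..t} T" using st by (auto intro: continuous_on_subset[OF c])
  qed (use st in auto)
  show "0 \<le> T s" if "0 \<le> s" "s \<le> b" for s using mono[of 0 s] T0 that by simp
  show "\<forall>\<^sub>F r in nhds s. (T has_real_derivative 1 / sqrt (2 * G r)) (at r)" if s: "0 < s" "s < b" for s
  proof -
    have "\<forall>\<^sub>F r in nhds s. r \<in> {0<..<b}" using s by (intro eventually_nhds_in_open) auto
    then show ?thesis by eventually_elim (use d in auto)
  qed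
qed

text \<open>If the bound fails, \<open>T u - |x - c|\<close> has a maximum above
  \<open>- \<rho>\<close>. It is not on the frontier, where \<open>T u = 0\<close> and the distance
  is at least \<open>\<rho>\<close>, so \<open>touching_profile\<close> applies with
  \<open>\<sigma> = 1\<close> and contradicts \<open>super\<close>.\<close>

lemma exterior_barrier:
  fixes u :: "'a::euclidean_space \<Rightarrow> real"
  assumes S: "open S" and u: "C_k_on 2 S u" and cu: "continuous_on (closure S) u"
    and u0: "\<forall>x\<in>frontier S. u x = 0" and ub: "\<forall>x\<in>S. 0 < u x \<and> u x < b"
    and ball: "ball c \<rho> \<inter> S = {}" and \<rho>: "\<rho> > 0"
    and G: "\<forall>s\<in>{0..b}. G s > 0" and T0: "T 0 = 0"
    and T: "\<forall>s\<in>{0..b}. (T has_real_derivative 1 / sqrt (2 * G s)) (at s within {0..b})"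
    and G': "\<And>s. 0 < s \<Longrightarrow> s < b \<Longrightarrow> (G has_real_derivative G' s) (at s)"
    and super: "\<forall>x\<in>S. (real DIM('a) - 1) * sqrt (2 * G (u x)) / \<rho> < laplacian u x - G' (u x)"
    and x: "x \<in> S"
  shows "T (u x) \<le> norm (x - c) - \<rho>"
proof (rule ccontr)
  note P = profile_properties[of b G T, OF G T0 T]
  assume "\<not> T (u x) \<le> norm (x - c) - \<rho>"
  then have fx: "T (u x) - norm (x - c) > - \<rho>" by simp
  have ucl: "u y \<in> {0..b}" if "y \<in> closure S" for y
    using that ub u0 x S by (cases "y \<in> S") (force simp: frontier_def interior_open)+
  have far: "norm (y - c) \<ge> \<rho>" if "y \<in> closure S" for y
  proof -
    have "ball c \<rho> \<inter> closure S = {}" using ball by (simp add: open_Int_closure_eq_empty)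
    then show ?thesis using that by (force simp: dist_norm norm_minus_commute)
  qed
  \<comment> \<open>Beyond distance \<open>B\<close> from \<open>c\<close> the function lies below
    its value at \<open>x\<close>, since \<open>T u\<close> never exceeds \<open>T b\<close>; this
    gives a maximum on the possibly unbounded \<open>S\<close>.\<close>
  define B where "B = norm (x - c) + T b + 1"
  have Tb: "T b \<ge> 0" using P(3)[of b] ub x by force
  have Tx: "T (u x) \<ge> 0" using P(3)[of "u x"] ub x by force
  define K where "K = closure S \<inter> cball c B"
  have xK: "x \<in> K" using x closure_subset[of S] Tb by (auto simp: K_def B_def dist_norm norm_minus_commute)
  have "continuous_on K (\<lambda>y. T (u y) - norm (y - c))"
    using ucl by (intro continuous_intros continuous_on_compose2[OF P(1)] continuous_on_subset[OF cu])
      (auto simp: K_def)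
  moreover have "compact K" by (auto simp: K_def closed_Int_compact)
  ultimately obtain y where y: "y \<in> K" "\<And>z. z \<in> K \<Longrightarrow> T (u z) - norm (z - c) \<le> T (u y) - norm (y - c)"
    using continuous_attains_sup[of K "\<lambda>y. T (u y) - norm (y - c)"] xK by blast
  have fy: "T (u y) - norm (y - c) > - \<rho>" using y(2)[OF xK] fx by simp
  have ycl: "y \<in> closure S" using y(1) by (simp add: K_def)
  have "u y \<noteq> 0" using fy far[OF ycl] T0 by auto
  then have yS: "y \<in> S" using u0 ycl S by (auto simp: frontier_def interior_open)
  have max: "T (u z) - norm (z - c) \<le> T (u y) - norm (y - c)" if z: "z \<in> S" for z
  proof (cases "z \<in> K")
    case False
    then have "norm (z - c) > B"
      using z closure_subset[of S] by (auto simp: K_def dist_norm norm_minus_commute)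
    moreover have "T (u z) \<le> T b" using ub z by (intro P(2)) (auto intro: less_imp_le)
    ultimately show ?thesis using y(2)[OF xK] Tx by (simp add: B_def)
  qed (use y in auto)
  have uy: "0 < u y" "u y < b" using ub yS by auto
  have "\<forall>\<^sub>F z in nhds y. z \<in> S" using S yS by (rule eventually_nhds_in_open)
  then have mx: "\<forall>\<^sub>F z in nhds y. 1 * T (u z) - norm (z - c) \<le> 1 * T (u y) - norm (y - c)"
    by eventually_elim (use max in auto)
  have "y \<noteq> c" using far[OF ycl] \<rho> by auto
  then have "1 * (laplacian u y - G' (u y)) \<le> (real DIM('a) - 1) * sqrt (2 * G (u y)) / norm (y - c)"
    by (intro touching_profile[OF S yS u _ _ P(4)[OF uy] G'[OF uy] _ mx]) (use uy G in auto)
  also have "\<dots> \<le> (real DIM('a) - 1) * sqrt (2 * G (u y)) / \<rho>"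
    using far[OF ycl] \<rho> bspec[OF G, of "u y"] uy
    by (intro divide_left_mono mult_nonneg_nonneg mult_pos_pos) auto
  finally show False using super yS by force
qed

text \<open>If the bound fails, \<open>T u + |x - c|\<close> falls below \<open>R\<close> in the
  annulus of width \<open>D\<close>. On the outer sphere it is at least \<open>R\<close> since
  \<open>T u\<close> is nonnegative; wherever \<open>u\<close> reaches \<open>b\<close>, in
  particular on the inner sphere, it is at least \<open>R\<close> since \<open>T b \<ge> D\<close>.
  Hence the minimum is interior with \<open>u < b\<close>, and \<open>touching_profile\<close>
  applies with \<open>\<sigma> = - 1\<close>.\<close>

lemma interior_barrier:
  fixes u :: "'a::euclidean_space \<Rightarrow> real"
  assumes S: "open S" and u: "C_k_on 2 S u" and cu: "continuous_on (closure S) u"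
    and upos: "\<forall>x\<in>closure S. 0 \<le> u x" "\<forall>x\<in>S. 0 < u x"
    and ball: "ball c R \<subseteq> S" and R: "0 < D" "D < R"
    and deep: "\<And>x. norm (x - c) \<le> R - D \<Longrightarrow> u x \<ge> b"
    and b: "b > 0"
    and G: "\<forall>s\<in>{0..b}. G s > 0" and T0: "T 0 = 0" and Tb: "T b \<ge> D"
    and T: "\<forall>s\<in>{0..b}. (T has_real_derivative 1 / sqrt (2 * G s)) (at s within {0..b})"
    and G': "\<And>s. 0 < s \<Longrightarrow> s < b \<Longrightarrow> (G has_real_derivative G' s) (at s)"
    and sub: "\<forall>x\<in>S. u x < b \<longrightarrow> (real DIM('a) - 1) * sqrt (2 * G (u x)) / (R - D) < G' (u x) - laplacian u x"
    and x: "x \<in> ball c R" "u x < b"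
  shows "R - norm (x - c) \<le> T (u x)"
proof (rule ccontr)
  note P = profile_properties[of b G T, OF G T0 T]
  assume "\<not> R - norm (x - c) \<le> T (u x)"
  then have fx: "T (u x) + norm (x - c) < R" by simp
  \<comment> \<open>The truncation keeps the argument in the interval where \<open>T\<close> is
    controlled, as \<open>u\<close> may exceed \<open>b\<close> in the annulus; near the minimum
    point it has no effect.\<close>
  define f where "f = (\<lambda>y. T (min (u y) b) + norm (y - c))"
  define K where "K = cball c R - ball c (R - D)"
  have cb: "cball c R \<subseteq> closure S"
    using closure_mono[OF ball] R by simp
  have xK: "x \<in> K"
    using x deep[of x] by (force simp: K_def dist_norm norm_minus_commute)
  have "continuous_on K f"
    unfolding f_def using cb upos(1) b
    by (intro continuous_intros continuous_on_compose2[OF P(1)] continuous_on_subset[OF cu])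
      (force simp: K_def)+
  moreover have "compact K" by (auto simp: K_def compact_diff)
  ultimately obtain y where y: "y \<in> K" "\<And>z. z \<in> K \<Longrightarrow> f y \<le> f z"
    using continuous_attains_inf[of K f] xK by blast
  have "f y \<le> f x" using y(2)[OF xK] .
  also have "f x < R" using fx x by (simp add: f_def)
  finally have fy: "f y < R" .
  have ycl: "y \<in> closure S" and yn: "norm (y - c) \<ge> R - D" "norm (y - c) \<le> R"
    using y(1) cb by (auto simp: K_def dist_norm norm_minus_commute)
  have "u y < b"
  proof (rule ccontr)
    assume "\<not> u y < b"
    then have "f y = T b + norm (y - c)" by (simp add: f_def min_def)
    then show False using fy Tb yn by simp
  qed
  moreover have "T (min (u y) b) \<ge> 0" using upos(1) ycl b by (intro P(3)) auto
  then have yR: "norm (y - c) < R" using fy by (simp add: f_def)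
  then have yS: "y \<in> S" using ball by (auto simp: dist_norm norm_minus_commute)
  ultimately have uy: "0 < u y" "u y < b" using upos(2) by auto
  have yD: "norm (y - c) > R - D" using deep[of y] uy by force
  have "u differentiable (at y)" using u yS by (simp add: numeral_2_eq_2)
  then have "isCont u y" by (rule differentiable_imp_continuous_within)
  then have "\<forall>\<^sub>F z in nhds y. u z < b"
    using uy(2) by (auto simp: isCont_def tendsto_at_iff_tendsto_nhds dest: order_tendstoD(2))
  moreover have "\<forall>\<^sub>F z in nhds y. z \<in> ball c R - cball c (R - D)"
    using yR yD by (intro eventually_nhds_in_open) (auto simp: dist_norm norm_minus_commute)
  ultimately have mx: "\<forall>\<^sub>F z in nhds y. - 1 * T (u z) - norm (z - c) \<le> - 1 * T (u y) - norm (y - c)"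
  proof eventually_elim
    case (elim z)
    then have "z \<in> K" by (auto simp: K_def)
    from y(2)[OF this] show ?case using elim uy by (simp add: f_def)
  qed
  have "y \<noteq> c" using yn R by auto
  then have "- 1 * (laplacian u y - G' (u y)) \<le> (real DIM('a) - 1) * sqrt (2 * G (u y)) / norm (y - c)"
    by (intro touching_profile[OF S yS u _ _ P(4)[OF uy] G'[OF uy] _ mx]) (use uy G in auto)
  also have "\<dots> \<le> (real DIM('a) - 1) * sqrt (2 * G (u y)) / (R - D)"
    using yn R bspec[OF G, of "u y"] uy
    by (intro divide_left_mono mult_nonneg_nonneg mult_pos_pos) auto
  finally show False using sub yS uy by force
qed

subsection \<open>The perturbed potentials\<close>

text \<open>This is how (W5) enters. Near 0 the function is either bounded away from 0 or has
  negative slope; on the remaining compact interval it has a negative maximum, and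
  \<open>s < 1\<close> turns a constant bound into a linear one.\<close>

lemma negative_linear_bound:
  fixes f :: "real \<Rightarrow> real"
  assumes f: "continuous_on {0..} f" and neg: "\<forall>s\<in>{0<..<1}. f s < 0"
    and d: "(f has_real_derivative a) (at 0 within {0..})"
    and nz: "f 0 \<noteq> 0 \<or> (f 0 = 0 \<and> a \<noteq> 0)"
    and m: "m < 1"
  obtains \<delta> where "\<delta> > 0" "\<And>s. 0 < s \<Longrightarrow> s \<le> m \<Longrightarrow> f s \<le> - \<delta> * s"
proof -
  have neg': "\<forall>\<^sub>F s in at_right 0. f s < 0"
    using neg by (auto simp: eventually_at_right_field intro!: exI[of _ 1])
  have "\<exists>\<eta>>0. \<exists>\<delta>>0. \<forall>s. 0 < s \<and> s < \<eta> \<longrightarrow> f s \<le> - \<delta> * s"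
  proof (cases "f 0 = 0")
    case True
    have "((\<lambda>s. (f s - f 0) / (s - 0)) \<longlongrightarrow> a) (at 0 within {0..})"
      using d by (simp add: has_field_derivative_iff)
    then have "((\<lambda>s. (f s - f 0) / (s - 0)) \<longlongrightarrow> a) (at_right 0)"
      by (rule tendsto_within_subset) auto
    then have L: "((\<lambda>s. f s / s) \<longlongrightarrow> a) (at_right 0)" by (simp add: True)
    moreover have "\<forall>\<^sub>F s in at_right 0. f s / s \<le> 0"
      using neg' eventually_at_right_less[of 0]
      by eventually_elim (simp add: divide_nonpos_pos)
    ultimately have "a \<le> 0" by (rule tendsto_upperbound) simp
    then have a: "a < 0" using nz True by simp
    then have "\<forall>\<^sub>F s in at_right 0. f s / s < a / 2" using L by (intro order_tendstoD(2)) auto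
    then obtain \<eta> where \<eta>: "\<eta> > 0" "\<And>s. 0 < s \<Longrightarrow> s < \<eta> \<Longrightarrow> f s / s < a / 2"
      by (auto simp: eventually_at_right_field)
    have "f s \<le> - (- a / 2) * s" if "0 < s" "s < \<eta>" for s
      using \<eta>(2)[OF that] that by (simp add: divide_less_eq)
    then show ?thesis using a \<eta>(1) by (intro exI[of _ \<eta>] conjI exI[of _ "- a / 2"]) auto
  next
    case False
    have "(f \<longlongrightarrow> f 0) (at 0 within {0..})" using f by (auto simp: continuous_on_def)
    then have L: "(f \<longlongrightarrow> f 0) (at_right 0)" by (rule tendsto_within_subset) auto
    then have "f 0 \<le> 0"
      by (rule tendsto_upperbound) (use neg' in \<open>auto elim: eventually_mono\<close>)
    then have a: "f 0 < 0" using False by simp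
    then have "\<forall>\<^sub>F s in at_right 0. f s < f 0 / 2" using L by (intro order_tendstoD(2)) auto
    then obtain \<eta> where \<eta>: "\<eta> > 0" "\<And>s. 0 < s \<Longrightarrow> s < \<eta> \<Longrightarrow> f s < f 0 / 2"
      by (auto simp: eventually_at_right_field)
    have "f s \<le> - (- f 0 / 2) * s" if "0 < s" "s < min \<eta> 1" for s
    proof -
      have "f s < f 0 / 2" using \<eta> that by simp
      also have "f 0 / 2 \<le> f 0 / 2 * s" using a that by (simp add: field_simps)
      finally show ?thesis by simp
    qed
    then show ?thesis using a \<eta>(1) by (intro exI[of _ "min \<eta> 1"] conjI exI[of _ "- f 0 / 2"]) auto
  qed
  then obtain \<eta> \<delta> where \<eta>: "\<eta> > 0" "\<delta> > 0" "\<And>s. 0 < s \<Longrightarrow> s < \<eta> \<Longrightarrow> f s \<le> - \<delta> * s" by blast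
  show thesis
  proof (cases "\<eta> \<le> m")
    case True
    have "continuous_on {\<eta>..m} f" using \<eta>(1) by (auto intro: continuous_on_subset[OF f])
    then obtain r where r: "r \<in> {\<eta>..m}" "\<And>s. s \<in> {\<eta>..m} \<Longrightarrow> f s \<le> f r"
      using continuous_attains_sup[of "{\<eta>..m}" f] True by auto
    have fr: "f r < 0" using neg r(1) \<eta>(1) m by auto
    show thesis
    proof (rule that[of "min \<delta> (- f r)"])
      show "min \<delta> (- f r) > 0" using fr \<eta> by simp
      fix s assume s: "0 < s" "s \<le> m"
      have le: "- \<delta> * s \<le> - min \<delta> (- f r) * s" "f r * s \<le> - min \<delta> (- f r) * s"
        using s by (intro mult_right_mono; auto simp: min_def)+
      show "f s \<le> - min \<delta> (- f r) * s"
      proof (cases "s < \<eta>")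
        case False
        then have "f s \<le> f r" using r(2) s by auto
        also have "f r \<le> f r * s" using fr s m by (simp add: mult_le_cancel_left1)
        finally show ?thesis using le by simp
      next
        case True
        then show ?thesis using \<eta>(3)[of s] s le(1) by linarith
      qed
    qed
  next
    case False
    then show thesis using \<eta> by (intro that[of \<delta>]) auto
  qed
qed

text \<open>\<open>G\<close> is \<open>W\<close> minus its tangent at a point \<open>m\<close> close to the well: the profile of \<open>G\<close> needs
  infinite time to reach \<open>m\<close>.\<close>
lemma tangent_potential:
  fixes W W' W'' :: "real \<Rightarrow> real"
  assumes W: "\<forall>s\<ge>0. (W has_real_derivative W' s) (at s within {0..})"
      "\<forall>s\<ge>0. (W' has_real_derivative W'' s) (at s within {0..})"
      "continuous_on {0..} W''"
    and W1: "\<forall>s\<ge>0. W s \<ge> 0" "W 1 = 0" "\<forall>s\<in>{0..<1}. W s > 0"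
    and W2: "\<gamma> \<in> {0<..<1}" "\<forall>s\<in>{\<gamma><..<1}. W' s < 0"
    and W3: "\<kappa> > 0" "\<forall>s\<ge>\<gamma>. W'' s \<ge> \<kappa>"
    and \<eta>: "\<eta> > 0"
  obtains m K where "0 < m" "m < 1" "W' m < 0" "K > 0"
    "W m - W' m * m \<le> \<eta>"
    "\<And>s. 0 \<le> s \<Longrightarrow> s < m \<Longrightarrow> W s - W m - W' m * (s - m) > 0"
    "\<And>s. 0 \<le> s \<Longrightarrow> s \<le> m \<Longrightarrow> 2 * (W s - W m - W' m * (s - m)) \<le> K * (m - s)\<^sup>2"
proof -
  have cW: "continuous_on {0..} W"
    using W(1) by (intro DERIV_continuous_on[of "{0..}" W W']) auto
  have cW': "continuous_on {0..} W'"
    using W(2) by (intro DERIV_continuous_on[of "{0..}" W' W'']) auto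
  have dW: "(W has_real_derivative W' s) (at s)" and dW': "(W' has_real_derivative W'' s) (at s)" if "s > 0" for s
  proof -
    have "at s within {0..} = at s" using that by (intro at_within_interior) (simp add: interior_Ici)
    then show "(W has_real_derivative W' s) (at s)" "(W' has_real_derivative W'' s) (at s)"
      using W(1,2) that by (metis less_imp_le)+
  qed
  have "W' 1 = 0"
    by (rule DERIV_local_min[OF dW, of 1 1]) (use W1 in auto)
  have "\<exists>\<mu>>0. \<forall>s\<in>{0..\<gamma>}. \<mu> \<le> W s"
  proof -
    have "continuous_on {0..\<gamma>} W" by (rule continuous_on_subset[OF cW]) auto
    then obtain r where "r \<in> {0..\<gamma>}" "\<And>s. s \<in> {0..\<gamma>} \<Longrightarrow> W r \<le> W s"
      using continuous_attains_inf[of "{0..\<gamma>}" W] W2(1) by auto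
    then show ?thesis using W1(3) W2(1) by (intro exI[of _ "W r"]) auto
  qed
  then obtain \<mu> where \<mu>: "\<mu> > 0" "\<And>s. s \<in> {0..\<gamma>} \<Longrightarrow> \<mu> \<le> W s" by blast
  \<comment> \<open>Both \<open>W\<close> and \<open>W'\<close> vanish at 1, so \<open>m\<close> can
    be taken close to 1 with \<open>W m - W' m\<close> small: below \<open>\<mu>\<close> for
    positivity of \<open>G\<close> on \<open>{0..\<gamma>}\<close>, below \<open>\<eta>\<close> so
    that \<open>G 0\<close> stays close to \<open>W 0\<close>.\<close>
  have "isCont (\<lambda>s. W s - W' s) 1"
    using DERIV_isCont[OF dW[of 1]] DERIV_isCont[OF dW'[of 1]] by (intro continuous_diff) auto
  then have "((\<lambda>s. W s - W' s) \<longlongrightarrow> 0) (at_left 1)"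
    using W1(2) \<open>W' 1 = 0\<close> by (auto simp: isCont_def intro: tendsto_within_subset)
  then have "\<forall>\<^sub>F s in at_left 1. W s - W' s < min \<mu> \<eta>"
    using \<mu>(1) \<eta> by (intro order_tendstoD(2)) auto
  moreover have "\<forall>\<^sub>F s in at_left 1. s \<in> {\<gamma><..<1}"
    using W2(1) by (intro eventually_at_leftI[of \<gamma>]) auto
  ultimately have "\<forall>\<^sub>F s in at_left 1. W s - W' s < min \<mu> \<eta> \<and> s \<in> {\<gamma><..<1}"
    by eventually_elim auto
  then obtain m where m: "W m - W' m < min \<mu> \<eta>" "\<gamma> < m" "m < 1"
    using eventually_happens'[OF trivial_limit_at_left_real] by force
  have m0: "0 < m" using m W2 by simp
  have W'm: "W' m < 0" using W2 m by auto
  have Wm: "W m \<ge> 0" using W1 m0 by simp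
  have cW'': "continuous_on {0..m} (\<lambda>s. \<bar>W'' s\<bar>)"
    by (intro continuous_intros continuous_on_subset[OF W(3)]) auto
  have "{0..m} \<noteq> {}" using m0 by simp
  then obtain r where r: "\<And>s. s \<in> {0..m} \<Longrightarrow> \<bar>W'' s\<bar> \<le> \<bar>W'' r\<bar>"
    using continuous_attains_sup[OF compact_Icc _ cW''] by blast
  define K where "K = \<bar>W'' r\<bar> + 1"
  have K: "K > 0" "\<And>s. s \<in> {0..m} \<Longrightarrow> \<bar>W'' s\<bar> \<le> K" using r by (force simp: K_def)+
  define G where "G = (\<lambda>s. W s - W m - W' m * (s - m))"
  have cG: "continuous_on {0..} G" unfolding G_def by (intro continuous_intros cW)
  have dG: "(G has_real_derivative W' s - W' m) (at s)" if "s > 0" for s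
    unfolding G_def using dW[OF that] by (auto intro!: derivative_eq_intros)
  have Gm: "G m = 0" by (simp add: G_def)
  have incr: "W' s < W' m" if s: "\<gamma> < s" "s < m" for s
  proof (rule DERIV_pos_imp_increasing_open[of s m W'])
    show "\<exists>y. (W' has_real_derivative y) (at x) \<and> 0 < y" if x: "s < x" "x < m" for x
    proof (intro exI conjI)
      show "(W' has_real_derivative W'' x) (at x)" using dW' x s W2 by auto
      show "W'' x > 0" using W3 x s by (smt (verit))
    qed
    show "continuous_on {s..m} W'" using s W2 by (auto intro: continuous_on_subset[OF cW'])
  qed (use s in auto)
  \<comment> \<open>Left of \<open>\<gamma>\<close> the lower bound \<open>\<mu>\<close> wins, as
    \<open>s - m\<close> is at least \<open>-1\<close>; right of it \<open>W'\<close> is strictly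
    increasing, so \<open>W\<close> lies above its tangent at \<open>m\<close>.\<close>
  have Gpos: "G s > 0" if s: "0 \<le> s" "s < m" for s
  proof (cases "s \<le> \<gamma>")
    case True
    have "W' m * (s - m) \<le> - W' m"
      using W'm s m mult_left_mono_neg[of "-1" "s - m" "W' m"] by simp
    then show ?thesis using \<mu>(2)[of s] True s m(1) by (simp add: G_def)
  next
    case False
    have "G m < G s"
    proof (rule DERIV_neg_imp_decreasing_open[of s m G])
      show "\<exists>y. (G has_real_derivative y) (at x) \<and> y < 0" if "s < x" "x < m" for x
        using dG[of x] incr[of x] that False s by (intro exI[of _ "W' x - W' m"]) auto
      show "continuous_on {s..m} G" using s by (auto intro: continuous_on_subset[OF cG])
    qed (use s in auto)
    then show ?thesis by (simp add: Gm)
  qed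
  have lip: "W' m - W' s \<le> K * (m - s)" if s: "0 < s" "s < m" for s
  proof -
    obtain \<xi> where \<xi>: "s < \<xi>" "\<xi> < m" "W' m - W' s = (m - s) * W'' \<xi>"
      using MVT2[of s m W' W''] dW' s by force
    have "W'' \<xi> \<le> K" using K(2)[of \<xi>] \<xi> s by force
    then show ?thesis using s by (simp add: \<xi>(3) mult.commute mult_left_mono)
  qed
  \<comment> \<open>Both sides vanish at \<open>m\<close>, and the Lipschitz bound on
    \<open>W'\<close> makes their difference increase up to there.\<close>
  have Gup: "2 * G s \<le> K * (m - s)\<^sup>2" if s: "0 \<le> s" "s \<le> m" for s
  proof -
    have "2 * G s - K * (m - s)\<^sup>2 \<le> 2 * G m - K * (m - m)\<^sup>2"
    proof (rule DERIV_nonneg_imp_increasing_open[of s m "\<lambda>s. 2 * G s - K * (m - s)\<^sup>2"])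
      show "\<exists>y. ((\<lambda>s. 2 * G s - K * (m - s)\<^sup>2) has_real_derivative y) (at x) \<and> 0 \<le> y"
        if x: "s < x" "x < m" for x
      proof (intro exI conjI)
        show "((\<lambda>s. 2 * G s - K * (m - s)\<^sup>2) has_real_derivative
            2 * (W' x - W' m) + 2 * (K * (m - x))) (at x)"
          using dG[of x] x s by (auto intro!: derivative_eq_intros simp: algebra_simps)
        show "0 \<le> 2 * (W' x - W' m) + 2 * (K * (m - x))" using lip[of x] x s by simp
      qed
      show "continuous_on {s..m} (\<lambda>s. 2 * G s - K * (m - s)\<^sup>2)"
        using s by (intro continuous_intros continuous_on_subset[OF cG]) auto
    qed (use s in auto)
    then show ?thesis by (simp add: Gm)
  qed
  show thesis
  proof (rule that[of m K])
    have "- W' m * m \<le> - W' m" using W'm m by (simp add: mult_le_cancel_left1)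
    then show "W m - W' m * m \<le> \<eta>" using m(1) by simp
  qed (use m m0 W'm K Gpos Gup in \<open>auto simp: G_def\<close>)
qed

text \<open>Integrating \<open>1 / sqrt (2 * G s) \<ge> 1 / (sqrt K * (m - s))\<close> gives a
  logarithm that is unbounded as \<open>b\<close> approaches \<open>m\<close>; any prescribed depth
  can thus be reached before the profile exceeds \<open>m\<close>.\<close>

lemma profile_time_lower_bound:
  assumes G: "\<forall>s\<in>{0..b}. G s > 0" and T0: "T 0 = 0"
    and T: "\<forall>s\<in>{0..b}. (T has_real_derivative 1 / sqrt (2 * G s)) (at s within {0..b})"
    and b: "0 < b" "b < m" and K: "K > 0"
    and up: "\<And>s. 0 \<le> s \<Longrightarrow> s \<le> b \<Longrightarrow> 2 * G s \<le> K * (m - s)\<^sup>2"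
  shows "T b \<ge> (ln m - ln (m - b)) / sqrt K"
proof -
  note P = profile_properties[of b G T, OF G T0 T]
  let ?f = "\<lambda>s. T s + ln (m - s) / sqrt K"
  have "?f 0 \<le> ?f b"
  proof (rule DERIV_nonneg_imp_increasing_open[of 0 b ?f])
    show "\<exists>y. (?f has_real_derivative y) (at s) \<and> 0 \<le> y" if s: "0 < s" "s < b" for s
    proof (intro exI conjI)
      have d: "(T has_real_derivative 1 / sqrt (2 * G s)) (at s)"
        using bspec[OF T, of s] s by (simp add: at_within_Icc_at)
      show "(?f has_real_derivative 1 / sqrt (2 * G s) + (- 1 / (m - s)) / sqrt K) (at s)"
        using s b by (intro DERIV_add d DERIV_cdivide) (auto intro!: derivative_eq_intros)
      have "sqrt (2 * G s) \<le> sqrt (K * (m - s)\<^sup>2)" using up s by (simp only: real_sqrt_le_iff)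
      also have "\<dots> = (m - s) * sqrt K" using s b by (simp add: real_sqrt_mult)
      finally have "1 / ((m - s) * sqrt K) \<le> 1 / sqrt (2 * G s)"
        using bspec[OF G, of s] s b K by (intro divide_left_mono mult_pos_pos) auto
      then show "0 \<le> 1 / sqrt (2 * G s) + (- 1 / (m - s)) / sqrt K" by simp
    qed
    show "continuous_on {0..b} ?f" using b K by (intro continuous_intros P(1)) auto
  qed (use b in auto)
  then show ?thesis by (simp add: T0 diff_divide_distrib)
qed

subsection \<open>Bounds on the boundary gradient\<close>

text \<open>The constants are chosen in order: \<open>m\<close> and \<open>K\<close> from
  \<open>\<eta>\<close>, the radius \<open>d\<close> that forces \<open>u \<ge> m\<close>, then
  \<open>b\<close> with profile time at least \<open>D\<close>, and last a ball radius
  \<open>R\<close> whose curvature term is below \<open>- W' m\<close>. The gradient is then bounded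
  at the point where the ball touches the frontier.\<close>

lemma boundary_gradient_lower_bound:
  fixes u :: "'a::euclidean_space \<Rightarrow> real" and W W' W'' :: "real \<Rightarrow> real"
  assumes W_C2: "\<forall>s\<ge>0. (W has_real_derivative W' s) (at s within {0..})"
      "\<forall>s\<ge>0. (W' has_real_derivative W'' s) (at s within {0..})"
      "continuous_on {0..} W''"
    and W1: "\<forall>s\<ge>0. W s \<ge> 0" "W 1 = 0" "\<forall>s\<in>{0..<1}. W s > 0"
    and W2: "\<gamma> \<in> {0<..<1}" "\<forall>s\<in>{\<gamma><..<1}. W' s < 0"
    and W3: "\<kappa> > 0" "\<forall>s\<ge>\<gamma>. W'' s \<ge> \<kappa>"
    and W5: "\<forall>s\<in>{0<..<1}. W' s < 0" "W' 0 \<noteq> 0 \<or> (W' 0 = 0 \<and> W'' 0 \<noteq> 0)"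
    and S: "open S" and u: "C_k_on 2 S u" and C1: "C1_closure S u Du"
    and eq: "\<forall>x\<in>S. laplacian u x = W' (u x)"
    and upos: "\<forall>x\<in>S. u x > 0" and u0: "\<forall>x\<in>frontier S. u x = 0"
    and balls: "\<And>R. R > 0 \<Longrightarrow> \<exists>c z. z \<in> frontier S \<and> norm (z - c) = R \<and> ball c R \<subseteq> S"
    and \<eta>: "\<eta> > 0"
  obtains z where "z \<in> frontier S" "norm (Du z) \<ge> sqrt (2 * (W 0 - \<eta>))"
proof -
  obtain m K where m: "0 < m" "m < 1" "W' m < 0" and K: "K > 0"
    and G0: "W m - W' m * m \<le> \<eta>"
    and Gpos: "\<And>s. 0 \<le> s \<Longrightarrow> s < m \<Longrightarrow> W s - W m - W' m * (s - m) > 0"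
    and Gup: "\<And>s. 0 \<le> s \<Longrightarrow> s \<le> m \<Longrightarrow> 2 * (W s - W m - W' m * (s - m)) \<le> K * (m - s)\<^sup>2"
    using tangent_potential[OF W_C2 W1 W2 W3 \<eta>] by metis
  have cW: "continuous_on {0..} W"
    using W_C2(1) by (intro DERIV_continuous_on[of "{0..}" W W']) auto
  have cW': "continuous_on {0..} W'"
    using W_C2(2) by (intro DERIV_continuous_on[of "{0..}" W' W'']) auto
  have dW0: "(W' has_real_derivative W'' 0) (at 0 within {0..})" using W_C2(2) by auto
  obtain \<delta> where \<delta>: "\<delta> > 0" "\<And>s. 0 < s \<Longrightarrow> s \<le> m \<Longrightarrow> W' s \<le> - \<delta> * s"
    using negative_linear_bound[OF cW' W5(1) dW0 W5(2) m(2)] by blast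
  define G where "G = (\<lambda>s. W s - W m - W' m * (s - m))"
  let ?n = "real DIM('a)"
  \<comment> \<open>The radius required by \<open>interior_lower_bound\<close>; the added 1 makes
    that inequality strict.\<close>
  define d where "d = sqrt (?n * (?n + 2)\<^sup>2 / \<delta> + 1)"
  have rad: "?n * (?n + 2)\<^sup>2 / \<delta> + 1 > 0" using \<delta> by (intro add_nonneg_pos) auto
  then have d: "d > 0" by (simp add: d_def)
  have d2: "?n * (?n + 2)\<^sup>2 < \<delta> * d\<^sup>2"
    using rad \<delta>(1) by (simp add: d_def field_simps)
  \<comment> \<open>Twice \<open>d\<close>, so that a closed ball of radius \<open>d\<close> about
    any point at depth \<open>D\<close> lies inside the open tangent ball.\<close>
  define D where "D = 2 * d"
  \<comment> \<open>Solves \<open>ln m - ln (m - b) = sqrt K * D\<close>, so the lower bound for the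
    profile time is exactly \<open>D\<close>.\<close>
  define b where "b = m - m * exp (- (sqrt K * D))"
  have b: "0 < b" "b < m" using m K d by (auto simp: b_def D_def)
  have Gb: "\<forall>s\<in>{0..b}. G s > 0" using Gpos b by (auto simp: G_def)
  have cG: "continuous_on {0..b} G"
    unfolding G_def by (intro continuous_intros continuous_on_subset[OF cW]) auto
  obtain T where T: "T 0 = 0" "\<forall>s\<in>{0..b}. (T has_real_derivative 1 / sqrt (2 * G s)) (at s within {0..b})"
    using profile_exists[OF cG Gb] by blast
  have "(ln m - ln (m - b)) / sqrt K \<le> T b"
    using profile_time_lower_bound[OF Gb T b K] Gup b by (auto simp: G_def)
  moreover have "ln (m - b) = ln m - sqrt K * D" using m by (simp add: b_def ln_mult)
  ultimately have Tb: "D \<le> T b" using K by simp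
  \<comment> \<open>Subtracting the tangent shifts \<open>W'\<close> by the constant
    \<open>- W' m\<close>, so \<open>\<epsilon>\<close> is the gap
    \<open>G' (u x) - laplacian u x\<close> that the curvature term must not reach.\<close>
  define \<epsilon> where "\<epsilon> = - W' m"
  have \<epsilon>: "\<epsilon> > 0" using m by (simp add: \<epsilon>_def)
  define R where "R = D + ?n * sqrt K / \<epsilon> + 1"
  have RD: "R - D > 0" "?n * sqrt K < \<epsilon> * (R - D)"
    using K \<epsilon> by (auto simp: R_def field_simps intro: add_nonneg_pos)
  have D0: "D > 0" "D < R" using d RD by (auto simp: D_def)
  obtain c z where z: "z \<in> frontier S" "norm (z - c) = R" "ball c R \<subseteq> S"
    using balls[of R] D0 by force
  have deep: "u x \<ge> b" if x: "norm (x - c) \<le> R - D" for x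
  proof -
    have "cball x d \<subseteq> ball c R"
    proof
      fix y assume "y \<in> cball x d"
      then have "dist c y \<le> (R - D) + d"
        using x dist_triangle[of c y x] by (simp add: dist_norm norm_minus_commute)
      then show "y \<in> ball c R" using d by (simp add: D_def)
    qed
    then have "cball x d \<subseteq> S" using z(3) by blast
    moreover have "\<forall>x\<in>S. u x \<le> m \<longrightarrow> laplacian u x \<le> - \<delta> * u x" using eq upos \<delta>(2) by auto
    ultimately have "m \<le> u x" using interior_lower_bound[OF S u upos _ d d2] by blast
    then show ?thesis using b by simp
  qed
  have cu: "continuous_on (closure S) u" using C1 by (simp add: C1_closure_def)
  have unn: "\<forall>x\<in>closure S. 0 \<le> u x"
  proof
    fix x assume "x \<in> closure S"
    then have "x \<in> S \<or> x \<in> frontier S" using S by (auto simp: frontier_def interior_open)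
    then show "0 \<le> u x" using upos u0 by force
  qed
  have dG: "(G has_real_derivative W' s - W' m) (at s)" if "0 < s" "s < b" for s
  proof -
    have "at s within {0..} = at s" using that by (intro at_within_interior) (simp add: interior_Ici)
    then have "(W has_real_derivative W' s) (at s)" using W_C2(1) that by (metis less_imp_le)
    then show ?thesis unfolding G_def by (auto intro!: derivative_eq_intros)
  qed
  have sub: "\<forall>x\<in>S. u x < b \<longrightarrow>
      (?n - 1) * sqrt (2 * G (u x)) / (R - D) < (W' (u x) - W' m) - laplacian u x"
  proof (intro ballI impI)
    fix x assume x: "x \<in> S" "u x < b"
    have ux: "u x > 0" using upos x by auto
    have "2 * G (u x) \<le> K * (m - u x)\<^sup>2" using Gup[of "u x"] x b ux by (simp add: G_def)
    also have "\<dots> \<le> K * 1"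
      using K m ux x b by (intro mult_left_mono power_le_one) auto
    finally have "sqrt (2 * G (u x)) \<le> sqrt K" by simp
    then have "(?n - 1) * sqrt (2 * G (u x)) \<le> ?n * sqrt K"
      using Gb ux x by (intro mult_mono) (auto intro: less_imp_le)
    also have "\<dots> < \<epsilon> * (R - D)" by (rule RD(2))
    finally have "(?n - 1) * sqrt (2 * G (u x)) / (R - D) < \<epsilon>"
      using RD(1) by (simp add: pos_divide_less_eq)
    then show "(?n - 1) * sqrt (2 * G (u x)) / (R - D) < (W' (u x) - W' m) - laplacian u x"
      using eq x by (simp add: \<epsilon>_def)
  qed
  \<comment> \<open>The unit vector towards the centre: along it the distance to \<open>c\<close> is
    exactly \<open>R - t\<close>, so the barrier yields \<open>t \<le> T u\<close>.\<close>
  define e where "e = (c - z) /\<^sub>R R"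
  have ne: "norm e = 1" using z(2) D0 by (simp add: e_def norm_minus_commute)
  have seg: "z + t *\<^sub>R e - c = (1 - t / R) *\<^sub>R (z - c)" for t
    by (simp add: e_def algebra_simps divide_inverse)
  have nseg: "norm (z + t *\<^sub>R e - c) = R - t" if "0 < t" "t < R" for t
    unfolding seg norm_scaleR z(2) using that by (simp add: field_simps)
  have inball: "z + t *\<^sub>R e \<in> ball c R" if "0 < t" "t < R" for t
    using nseg[OF that] that by (simp add: dist_norm norm_minus_commute)
  have segS: "\<forall>\<^sub>F t in at_right 0. z + t *\<^sub>R e \<in> S"
    using inball z(3) D0 by (auto simp: eventually_at_right_field intro!: exI[of _ R])
  have zcl: "z \<in> closure S" "u z = 0" using z(1) u0 by (auto simp: frontier_def)
  have T0': "(T has_real_derivative 1 / sqrt (2 * G 0)) (at 0 within {0..b})" using T(2) b by simp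
  have L: "((\<lambda>t. T (u (z + t *\<^sub>R e)) / t) \<longlongrightarrow> 1 / sqrt (2 * G 0) * (Du z \<bullet> e)) (at_right 0)"
    using boundary_profile_derivative[OF C1 zcl upos segS T0' T(1) b(1)] .
  have "\<forall>\<^sub>F t in at_right 0. u (z + t *\<^sub>R e) < b"
  proof -
    have "((\<lambda>t. z + t *\<^sub>R e) \<longlongrightarrow> z + 0 *\<^sub>R e) (at_right 0)" by (intro tendsto_intros)
    then have l: "((\<lambda>t. z + t *\<^sub>R e) \<longlongrightarrow> z) (at_right 0)" by simp
    have "((\<lambda>t. u (z + t *\<^sub>R e)) \<longlongrightarrow> u z) (at_right 0)"
      by (rule continuous_on_tendsto_compose[OF cu l zcl(1)])
        (use segS closure_subset[of S] in \<open>auto elim!: eventually_mono\<close>)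
    then show ?thesis using b zcl by (intro order_tendstoD(2)) auto
  qed
  moreover have "\<forall>\<^sub>F t in at_right 0. 0 < t \<and> t < R"
    using D0 by (auto simp: eventually_at_right_field intro!: exI[of _ R])
  ultimately have "\<forall>\<^sub>F t in at_right 0. 1 \<le> T (u (z + t *\<^sub>R e)) / t"
  proof eventually_elim
    case (elim t)
    have "R - norm (z + t *\<^sub>R e - c) \<le> T (u (z + t *\<^sub>R e))"
      by (rule interior_barrier[OF S u cu unn upos z(3) D0 deep b(1) Gb T(1) Tb T(2) dG sub])
        (use inball elim in auto)
    then show ?case using elim nseg[of t] by (simp add: pos_le_divide_eq)
  qed
  then have "1 \<le> 1 / sqrt (2 * G 0) * (Du z \<bullet> e)"
    using L by (intro tendsto_lowerbound[OF L]) auto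
  then have "sqrt (2 * G 0) \<le> Du z \<bullet> e"
    using Gpos[of 0] m by (simp add: G_def field_simps)
  also have "\<dots> \<le> norm (Du z)" using norm_cauchy_schwarz[of "Du z" e] ne by simp
  finally have "sqrt (2 * G 0) \<le> norm (Du z)" .
  moreover have "sqrt (2 * (W 0 - \<eta>)) \<le> sqrt (2 * G 0)" using G0 by (simp add: G_def)
  ultimately show thesis by (intro that[OF z(1)]) linarith
qed

text \<open>The perturbation \<open>G\<close> stays positive up to \<open>b\<close>, even at 1 where
  \<open>W\<close> vanishes, and lowers \<open>W'\<close> by \<open>\<epsilon>\<close>, which beats
  the curvature of a large exterior ball. The bound covers every inward direction, so it can be used
  with the given normal without relating that normal to the centre of the ball.\<close>

lemma boundary_gradient_upper_bound:
  fixes u :: "'a::euclidean_space \<Rightarrow> real" and W W' :: "real \<Rightarrow> real"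
  assumes dW: "\<forall>s\<ge>0. (W has_real_derivative W' s) (at s within {0..})"
    and W0: "\<forall>s\<ge>0. W s \<ge> 0"
    and S: "open S" and u: "C_k_on 2 S u" and C1: "C1_closure S u Du"
    and eq: "\<forall>x\<in>S. laplacian u x = W' (u x)"
    and upos: "\<forall>x\<in>S. u x > 0" and u1: "\<forall>x\<in>S. u x \<le> 1" and u0: "\<forall>x\<in>frontier S. u x = 0"
    and balls: "\<And>R. R > 0 \<Longrightarrow> \<exists>c z. z \<in> frontier S \<and> norm (z - c) = R \<and> ball c R \<inter> S = {}"
    and \<eta>: "\<eta> > 0"
  obtains z where "z \<in> frontier S"
    "\<And>e. norm e = 1 \<Longrightarrow> \<forall>\<^sub>F t in at_right 0. z + t *\<^sub>R e \<in> S \<Longrightarrow> Du z \<bullet> e \<le> sqrt (2 * (W 0 + \<eta>))"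
proof -
  let ?n = "real DIM('a)"
  \<comment> \<open>Half of \<open>\<eta>\<close>, so that
    \<open>G 0 = W 0 + \<eta>\<close>.\<close>
  define \<epsilon> where "\<epsilon> = \<eta> / 2"
  have \<epsilon>: "\<epsilon> > 0" using \<eta> by (simp add: \<epsilon>_def)
  define G where "G = (\<lambda>s. W s + \<epsilon> * (2 - s))"
  \<comment> \<open>Strictly above the bound 1 for \<open>u\<close> and below 2, where the added
    term would vanish.\<close>
  define b :: real where "b = 3 / 2"
  have cW: "continuous_on {0..} W"
    using dW by (intro DERIV_continuous_on[of "{0..}" W W']) auto
  have cG: "continuous_on {0..b} G"
    unfolding G_def by (intro continuous_intros continuous_on_subset[OF cW]) auto
  have Gb: "\<forall>s\<in>{0..b}. G s > 0"
  proof
    fix s assume "s \<in> {0..b}"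
    then have "W s \<ge> 0" "\<epsilon> * (2 - s) > 0" using W0 \<epsilon> by (auto simp: b_def)
    then show "G s > 0" by (simp add: G_def)
  qed
  obtain T where T: "T 0 = 0" "\<forall>s\<in>{0..b}. (T has_real_derivative 1 / sqrt (2 * G s)) (at s within {0..b})"
    using profile_exists[OF cG Gb] by blast
  have "{0..b} \<noteq> {}" by (simp add: b_def)
  then obtain r where r: "\<And>s. s \<in> {0..b} \<Longrightarrow> G s \<le> G r"
    using continuous_attains_sup[OF compact_Icc _ cG] by blast
  define \<rho> where "\<rho> = ?n * sqrt (2 * G r) / \<epsilon> + 1"
  have "0 \<in> {0..b}" by (simp add: b_def)
  then have "0 < G 0" "G 0 \<le> G r" using Gb r by blast+
  then have Gr: "G r > 0" by linarith
  have \<rho>: "\<rho> > 0" "?n * sqrt (2 * G r) < \<epsilon> * \<rho>"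
    using \<epsilon> Gr by (auto simp: \<rho>_def field_simps intro: add_nonneg_pos)
  obtain c z where z: "z \<in> frontier S" "norm (z - c) = \<rho>" "ball c \<rho> \<inter> S = {}"
    using balls[OF \<rho>(1)] by blast
  have cu: "continuous_on (closure S) u" using C1 by (simp add: C1_closure_def)
  have ub: "\<forall>x\<in>S. 0 < u x \<and> u x < b" using upos u1 by (force simp: b_def)
  have dG: "(G has_real_derivative W' s - \<epsilon>) (at s)" if "0 < s" "s < b" for s
  proof -
    have "at s within {0..} = at s" using that by (intro at_within_interior) (simp add: interior_Ici)
    then have "(W has_real_derivative W' s) (at s)" using dW that by (metis less_imp_le)
    then show ?thesis unfolding G_def by (auto intro!: derivative_eq_intros)
  qed
  have super: "\<forall>x\<in>S. (?n - 1) * sqrt (2 * G (u x)) / \<rho> < laplacian u x - (W' (u x) - \<epsilon>)"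
  proof
    fix x assume x: "x \<in> S"
    have ux: "u x \<in> {0..b}" using ub x by force
    then have "(?n - 1) * sqrt (2 * G (u x)) \<le> ?n * sqrt (2 * G r)"
      using r[OF ux] Gb by (intro mult_mono) (auto intro: less_imp_le)
    also have "\<dots> < \<epsilon> * \<rho>" by (rule \<rho>(2))
    finally show "(?n - 1) * sqrt (2 * G (u x)) / \<rho> < laplacian u x - (W' (u x) - \<epsilon>)"
      using \<rho>(1) eq x by (simp add: pos_divide_less_eq)
  qed
  have zcl: "z \<in> closure S" "u z = 0" using z(1) u0 by (auto simp: frontier_def)
  have T0': "(T has_real_derivative 1 / sqrt (2 * G 0)) (at 0 within {0..b})" using T(2) by (simp add: b_def)
  have b0: "b > 0" by (simp add: b_def)
  show thesis
  proof (rule that[OF z(1)])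
    fix e :: 'a assume e: "norm e = 1" and seg: "\<forall>\<^sub>F t in at_right 0. z + t *\<^sub>R e \<in> S"
    have L: "((\<lambda>t. T (u (z + t *\<^sub>R e)) / t) \<longlongrightarrow> 1 / sqrt (2 * G 0) * (Du z \<bullet> e)) (at_right 0)"
      using boundary_profile_derivative[OF C1 zcl upos seg T0' T(1) b0] .
    have "\<forall>\<^sub>F t in at_right 0. T (u (z + t *\<^sub>R e)) / t \<le> 1"
      using seg eventually_at_right_less[of 0]
    proof eventually_elim
      case (elim t)
      have "T (u (z + t *\<^sub>R e)) \<le> norm (z + t *\<^sub>R e - c) - \<rho>"
        by (rule exterior_barrier[OF S u cu u0 ub z(3) \<rho>(1) Gb T dG super elim(1)])
      \<comment> \<open>A unit-speed segment starting on the sphere of radius \<open>\<rho>\<close>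
        moves away from \<open>c\<close> by at most \<open>t\<close>.\<close>
      also have "\<dots> \<le> t"
        using norm_triangle_ineq[of "z - c" "t *\<^sub>R e"] z(2) e elim(2) by (simp add: algebra_simps)
      finally show ?case using elim(2) by simp
    qed
    then have "1 / sqrt (2 * G 0) * (Du z \<bullet> e) \<le> 1"
      by (intro tendsto_upperbound[OF L]) auto
    then have "Du z \<bullet> e \<le> sqrt (2 * G 0)"
      using Gb by (simp add: b_def field_simps)
    then show "Du z \<bullet> e \<le> sqrt (2 * (W 0 + \<eta>))" by (simp add: G_def \<epsilon>_def)
  qed
qed

section \<open>Combining the two bounds through the constant normal derivative\<close>

theorem theorem1p5:
  fixes \<phi> :: "real ^ 'm \<Rightarrow> real"
    and \<Omega> :: "((real ^ 'm) \<times> real) set"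
    and W W' W'' :: "real \<Rightarrow> real"
    and \<gamma> \<kappa> p c :: real
    and u :: "(real ^ 'm) \<times> real \<Rightarrow> real"
    and Du :: "(real ^ 'm) \<times> real \<Rightarrow> (real ^ 'm) \<times> real"
    and \<nu> :: "(real ^ 'm) \<times> real \<Rightarrow> (real ^ 'm) \<times> real"
  assumes phi_smooth: "smooth \<phi>"
    and Omega: "\<Omega> = strict_epigraph \<phi>"
    and W_C2: "\<forall>s\<ge>0. (W has_real_derivative W' s) (at s within {0..})"
      "\<forall>s\<ge>0. (W' has_real_derivative W'' s) (at s within {0..})"
      "continuous_on {0..} W''"
    and W1: "\<forall>s\<ge>0. W s \<ge> 0" "W 1 = 0" "\<forall>s\<in>{0..<1}. W s > 0"
    and W2: "\<gamma> \<in> {0<..<1}" "\<forall>s\<in>{\<gamma><..<1}. W' s < 0"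
    and W3: "\<kappa> > 0" "\<forall>s\<ge>\<gamma>. W'' s \<ge> \<kappa>"
    and W4: "p > 1" "c > 0" "\<forall>s>1. W' s \<ge> c * (s - 1) powr p"
    and W5: "\<forall>s\<in>{0<..<1}. W' s < 0" "W' 0 \<noteq> 0 \<or> (W' 0 = 0 \<and> W'' 0 \<noteq> 0)"
    and u_C2: "C_k_on 2 \<Omega> u"
    and u_C1: "C1_closure \<Omega> u Du"
    and equation: "\<forall>x\<in>\<Omega>. laplacian u x = W' (u x)"
    and u_pos: "\<forall>x\<in>\<Omega>. u x > 0"
    and dirichlet: "\<forall>x\<in>frontier \<Omega>. u x = 0"
    and normal: "\<forall>x\<in>frontier \<Omega>. outer_unit_normal \<Omega> x (\<nu> x)"
    and neumann: "\<exists>k. \<forall>x\<in>frontier \<Omega>. Du x \<bullet> \<nu> x = k"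
  shows "\<forall>x\<in>frontier \<Omega>. norm (Du x) = sqrt (2 * W 0)"
proof
  fix x assume x: "x \<in> frontier \<Omega>"
  have phi1: "C_k_on 1 UNIV \<phi>" using phi_smooth by (simp add: smooth_def)
  then have cphi: "continuous_on UNIV \<phi>"
    by (auto intro!: continuous_at_imp_continuous_on differentiable_imp_continuous_within)
  have op: "open \<Omega>"
  proof -
    have "continuous_on UNIV (\<lambda>p::(real ^ 'm) \<times> real. \<phi> (fst p))"
      by (rule continuous_on_compose2[OF cphi]) (auto intro!: continuous_intros)
    then show ?thesis
      unfolding Omega strict_epigraph_def by (intro open_Collect_less continuous_intros)
  qed
  obtain k where k: "\<And>y. y \<in> frontier \<Omega> \<Longrightarrow> Du y \<bullet> \<nu> y = k" using neumann by blast
  \<comment> \<open>The gradient is normal, so its norm is the same at all boundary points; a bound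
    at one touching point therefore holds everywhere.\<close>
  have nk: "norm (Du y) = \<bar>k\<bar>" if y: "y \<in> frontier \<Omega>" for y
    using gradient_normal_strict_epigraph[OF phi1, of u Du y "\<nu> y"] u_C1 dirichlet normal y k[OF y]
    unfolding Omega by simp
  have inward: "norm (- \<nu> y) = 1" "\<forall>\<^sub>F t in at_right 0. y + t *\<^sub>R (- \<nu> y) \<in> \<Omega>"
    if "y \<in> frontier \<Omega>" for y
  proof -
    have n: "outer_unit_normal \<Omega> y (\<nu> y)" using normal that by blast
    then show "norm (- \<nu> y) = 1" by (simp add: outer_unit_normal_def)
    have "\<forall>\<^sub>F t in at_right 0. y + t *\<^sub>R \<nu> y \<notin> \<Omega> \<and> y - t *\<^sub>R \<nu> y \<in> \<Omega>"
      using n by (simp add: outer_unit_normal_def)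
    then show "\<forall>\<^sub>F t in at_right 0. y + t *\<^sub>R (- \<nu> y) \<in> \<Omega>" by eventually_elim simp
  qed
  have cu: "continuous_on (closure \<Omega>) u" using u_C1 by (simp add: C1_closure_def)
  have u1: "\<forall>y\<in>\<Omega>. u y \<le> 1"
    using Keller_Osserman_le_1[OF op u_C2 cu _ W4(1,2)] dirichlet equation W4(3) by auto
  have lower: "2 * (W 0 - \<eta>) \<le> k\<^sup>2" if \<eta>: "\<eta> > 0" for \<eta>
  proof -
    have "\<exists>c z. z \<in> frontier \<Omega> \<and> norm (z - c) = R \<and> ball c R \<subseteq> \<Omega>" if "R > 0" for R
      using strict_epigraph_interior_ball[OF cphi that] unfolding Omega by metis
    then obtain z where "z \<in> frontier \<Omega>" "norm (Du z) \<ge> sqrt (2 * (W 0 - \<eta>))"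
      using boundary_gradient_lower_bound[OF W_C2 W1 W2 W3 W5 op u_C2 u_C1 equation u_pos dirichlet _ \<eta>]
      by metis
    then have "sqrt (2 * (W 0 - \<eta>)) \<le> \<bar>k\<bar>" using nk by simp
    then have "sqrt (2 * (W 0 - \<eta>)) \<le> sqrt (k\<^sup>2)" by simp
    then show ?thesis by (simp only: real_sqrt_le_iff)
  qed
  \<comment> \<open>The upper bound below is one-sided in \<open>- k\<close>. Since \<open>u\<close>
    is positive inside and zero on the frontier, its inward derivative is nonnegative, which permits
    squaring.\<close>
  have "- k \<ge> 0"
  proof -
    have "x \<in> closure \<Omega>" "u x = 0" using x dirichlet by (auto simp: frontier_def)
    then have "((\<lambda>t. u (x + t *\<^sub>R (- \<nu> x)) / t) \<longlongrightarrow> Du x \<bullet> (- \<nu> x)) (at_right 0)"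
      using boundary_directional_derivative[OF u_C1 _ inward(2)[OF x]] by simp
    moreover have "\<forall>\<^sub>F t in at_right 0. 0 \<le> u (x + t *\<^sub>R (- \<nu> x)) / t"
      using inward(2)[OF x] eventually_at_right_less[of 0]
      by eventually_elim (use u_pos in \<open>auto intro!: divide_nonneg_pos less_imp_le\<close>)
    ultimately have "0 \<le> Du x \<bullet> (- \<nu> x)" by (rule tendsto_lowerbound) simp
    then show ?thesis using k[OF x] by simp
  qed
  moreover have upper: "- k \<le> sqrt (2 * (W 0 + \<eta>))" if \<eta>: "\<eta> > 0" for \<eta>
  proof -
    have "\<exists>c z. z \<in> frontier \<Omega> \<and> norm (z - c) = R \<and> ball c R \<inter> \<Omega> = {}" if "R > 0" for R
      using strict_epigraph_exterior_ball[OF cphi that] unfolding Omega by metis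
    then obtain z where z: "z \<in> frontier \<Omega>" and le:
      "\<And>e. norm e = 1 \<Longrightarrow> \<forall>\<^sub>F t in at_right 0. z + t *\<^sub>R e \<in> \<Omega> \<Longrightarrow> Du z \<bullet> e \<le> sqrt (2 * (W 0 + \<eta>))"
      using boundary_gradient_upper_bound[OF W_C2(1) W1(1) op u_C2 u_C1 equation u_pos u1 dirichlet _ \<eta>]
      by metis
    have "Du z \<bullet> (- \<nu> z) \<le> sqrt (2 * (W 0 + \<eta>))"
      by (rule le[OF inward[OF z]])
    then show ?thesis using k[OF z] by simp
  qed
  ultimately have upper2: "k\<^sup>2 \<le> 2 * (W 0 + \<eta>)" if "\<eta> > 0" for \<eta>
    using that W1(1) power_mono[of "- k" "sqrt (2 * (W 0 + \<eta>))" 2] by (simp add: add_nonneg_nonneg)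
  \<comment> \<open>The touching points depend on \<open>\<eta>\<close> but \<open>k\<close> does
    not, so \<open>\<eta>\<close> may tend to 0.\<close>
  have "k\<^sup>2 \<le> 2 * W 0"
  proof (rule field_le_epsilon)
    show "k\<^sup>2 \<le> 2 * W 0 + e" if "e > 0" for e using upper2[of "e / 2"] that by simp
  qed
  moreover have "2 * W 0 \<le> k\<^sup>2"
  proof (rule field_le_epsilon)
    show "2 * W 0 \<le> k\<^sup>2 + e" if "e > 0" for e using lower[of "e / 2"] that by (simp add: algebra_simps)
  qed
  ultimately have "k\<^sup>2 = 2 * W 0" by simp
  then show "norm (Du x) = sqrt (2 * W 0)" using nk[OF x] by (metis real_sqrt_abs)
qed

end
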